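(* The following are equivalent for a commutative ring $R$ with identity and an $R$-module $M$: (1) the trivial extension $A=R\propto M$ is a CS ring; (2) $M$ satisfies the following two conditions: (a) $\mathrm{Ann}_R(M)$ is a direct summand of $R$ which is a CS ring, and (b) $M$ is a weakly IN $R$-module; (3) $M$ satisfies the following two conditions: (a) $\mathrm{Ann}_R(M)$ is a direct summand of $R$ which is a CS ring, and (b) $M$ is a strongly CS $R$-module; (4) $M\oplus \mathrm{Ann}_R(M)$ is a weakly IN $R$-module; (5) $M\oplus \mathrm{Ann}_R(M)$ is a strongly CS $R$-module.
   Context: All rings are commutative with identity and all modules are unital. For an $R$-module $N$, $\mathrm{Ann}_R(N)=\{r\in R\mid rN=0\}$. The trivial extension $R\propto M$ is the abelian group $R\oplus M$ with multiplication $(a,x)(b,y)=(ab,ay+bx)$. A module is CS if every submodule is an essential submodule of a direct summand; a ring is a CS ring if it is CS as a module over itself. An $R$-module $M$ is weakly IN if $\mathrm{Ann}_R(N)+\mathrm{Ann}_R(L)=R$ for all submodules $N,L$ of $M$ with $N\cap L=0$. $M$ is strongly CS if for every submodule $N$ of $M$ there exists an idempotent $e=e^2\in R$ such that $N$ is an essential submodule of $eM$. The phrase "$\mathrm{Ann}_R(M)$ is a direct summand of $R$ which is a CS ring" means that there is an idempotent $e\in R$ with $\mathrm{Ann}_R(M)=eR$ and that $eR$, viewed as a ring with identity $e$, is a CS ring (the zero ring is counted as a CS ring). *)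

theory Defs
  imports "HOL-Algebra.Algebra"
begin

definition regular_module :: "('a, 'r) ring_scheme \<Rightarrow> ('a, 'a) module"
  where "regular_module R =
    \<lparr>carrier = carrier R, monoid.mult = monoid.mult R, one = one R, ring.zero = ring.zero R, add = add R,
     smult = monoid.mult R\<rparr>"

text \<open>The fields \<open>mult\<close> and \<open>one\<close> of a record of type \<open>module\<close> play no role for modules;
  in \<open>RDirProd\<close> they are just carried along componentwise.\<close>

definition direct_sum ::
  "('a, 'b, 'm) module_scheme \<Rightarrow> ('a, 'c, 'n) module_scheme \<Rightarrow> ('a, 'b \<times> 'c) module"
  where "direct_sum M N = ring.extend (RDirProd M N)
    \<lparr>smult = (\<lambda>r (x, y). (r \<odot>\<^bsub>M\<^esub> x, r \<odot>\<^bsub>N\<^esub> y))\<rparr>"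

definition trivial_extension ::
  "('a, 'r) ring_scheme \<Rightarrow> ('a, 'b, 'm) module_scheme \<Rightarrow> ('a \<times> 'b) ring"
  where "trivial_extension R M =
    \<lparr>carrier = carrier R \<times> carrier M,
     monoid.mult = (\<lambda>(a, x) (b, y). (a \<otimes>\<^bsub>R\<^esub> b, a \<odot>\<^bsub>M\<^esub> y \<oplus>\<^bsub>M\<^esub> b \<odot>\<^bsub>M\<^esub> x)),
     one = (\<one>\<^bsub>R\<^esub>, \<zero>\<^bsub>M\<^esub>),
     ring.zero = (\<zero>\<^bsub>R\<^esub>, \<zero>\<^bsub>M\<^esub>),
     add = (\<lambda>(a, x) (b, y). (a \<oplus>\<^bsub>R\<^esub> b, x \<oplus>\<^bsub>M\<^esub> y))\<rparr>"

definition annihilator ::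
  "('a, 'r) ring_scheme \<Rightarrow> ('a, 'b, 'm) module_scheme \<Rightarrow> 'b set \<Rightarrow> 'a set"
  where "annihilator R M N = {r \<in> carrier R. \<forall>x \<in> N. r \<odot>\<^bsub>M\<^esub> x = \<zero>\<^bsub>M\<^esub>}"

definition essential_submodule ::
  "('a, 'r) ring_scheme \<Rightarrow> ('a, 'b, 'm) module_scheme \<Rightarrow> 'b set \<Rightarrow> 'b set \<Rightarrow> bool"
  where "essential_submodule R M N K \<longleftrightarrow>
    submodule N R M \<and> submodule K R M \<and> N \<subseteq> K \<and>
    (\<forall>L. submodule L R M \<longrightarrow> L \<subseteq> K \<longrightarrow> N \<inter> L = {\<zero>\<^bsub>M\<^esub>} \<longrightarrow> L = {\<zero>\<^bsub>M\<^esub>})"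

definition direct_summand ::
  "('a, 'r) ring_scheme \<Rightarrow> ('a, 'b, 'm) module_scheme \<Rightarrow> 'b set \<Rightarrow> bool"
  where "direct_summand R M K \<longleftrightarrow>
    submodule K R M \<and>
    (\<exists>L. submodule L R M \<and> K \<inter> L = {\<zero>\<^bsub>M\<^esub>} \<and> K <+>\<^bsub>M\<^esub> L = carrier M)"

definition CS_module ::
  "('a, 'r) ring_scheme \<Rightarrow> ('a, 'b, 'm) module_scheme \<Rightarrow> bool"
  where "CS_module R M \<longleftrightarrow>
    (\<forall>N. submodule N R M \<longrightarrow> (\<exists>K. direct_summand R M K \<and> essential_submodule R M N K))"

definition CS_ring :: "('a, 'r) ring_scheme \<Rightarrow> bool"
  where "CS_ring R \<longleftrightarrow> CS_module R (regular_module R)"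

definition weakly_IN_module ::
  "('a, 'r) ring_scheme \<Rightarrow> ('a, 'b, 'm) module_scheme \<Rightarrow> bool"
  where "weakly_IN_module R M \<longleftrightarrow>
    (\<forall>N L. submodule N R M \<longrightarrow> submodule L R M \<longrightarrow> N \<inter> L = {\<zero>\<^bsub>M\<^esub>} \<longrightarrow>
      annihilator R M N <+>\<^bsub>R\<^esub> annihilator R M L = carrier R)"

definition strongly_CS_module ::
  "('a, 'r) ring_scheme \<Rightarrow> ('a, 'b, 'm) module_scheme \<Rightarrow> bool"
  where "strongly_CS_module R M \<longleftrightarrow>
    (\<forall>N. submodule N R M \<longrightarrow>
      (\<exists>e \<in> carrier R. e \<otimes>\<^bsub>R\<^esub> e = e \<and>
        essential_submodule R M N ((\<lambda>x. e \<odot>\<^bsub>M\<^esub> x) ` carrier M)))"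

text \<open>For an idempotent \<open>e\<close>, the ideal \<open>eR\<close> is a ring with identity \<open>e\<close>, but in general
  not a subring of \<open>R\<close>; it may be the zero ring.\<close>

definition idempotent_ring :: "('a, 'r) ring_scheme \<Rightarrow> 'a \<Rightarrow> ('a, 'r) ring_scheme"
  where "idempotent_ring R e = R\<lparr>carrier := PIdl\<^bsub>R\<^esub> e, one := e\<rparr>"

definition CS_ring_direct_summand :: "('a, 'r) ring_scheme \<Rightarrow> 'a set \<Rightarrow> bool"
  where "CS_ring_direct_summand R I \<longleftrightarrow>
    (\<exists>e \<in> carrier R. e \<otimes>\<^bsub>R\<^esub> e = e \<and> I = PIdl\<^bsub>R\<^esub> e \<and> CS_ring (idempotent_ring R e))"

definition annihilator_module ::
  "('a, 'r) ring_scheme \<Rightarrow> ('a, 'b, 'm) module_scheme \<Rightarrow> ('a, 'a) module"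
  where "annihilator_module R M = (regular_module R)\<lparr>carrier := annihilator R M (carrier M)\<rparr>"

lemma (in cring) regular_module_module: "module R (regular_module R)"
  by (rule moduleI)
     (auto simp: regular_module_def l_distr r_distr m_assoc is_cring a_ac
        intro!: abelian_groupI dest: abelian_groupE(6)[OF is_abelian_group])

lemma (in cring) cring_idempotent_ring:
  assumes e: "e \<in> carrier R" "e \<otimes> e = e"
  shows "cring (idempotent_ring R e)"
proof -
  have ideal: "ideal (PIdl e) R"
    using e(1) by (rule cgenideal_ideal)
  then have subgroup: "subgroup (PIdl e) (add_monoid R)"
    by (simp add: ideal_def additive_subgroup_def)
  have sub: "x \<in> carrier R" if "x \<in> PIdl e" for x
    using subgroup.mem_carrier[OF subgroup that] by simp
  have add: "x \<oplus> y \<in> PIdl e" if "x \<in> PIdl e" "y \<in> PIdl e" for x y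
    using subgroup.m_closed[OF subgroup that] by simp
  have zero: "\<zero> \<in> PIdl e"
    using subgroup.one_closed[OF subgroup] by simp
  have neg: "\<exists>y\<in>PIdl e. x \<oplus> y = \<zero>" if "x \<in> PIdl e" for x
    using subgroup.m_inv_closed[OF subgroup that] r_neg[OF sub[OF that]]
    unfolding a_inv_def by blast
  have mult: "x \<otimes> y \<in> PIdl e" if "x \<in> PIdl e" "y \<in> PIdl e" for x y
    using ideal.I_l_closed[OF ideal that(2) sub[OF that(1)]] .
  have e': "e \<in> PIdl e"
    using e(1) by (rule cgenideal_self)
  have unit: "e \<otimes> x = x" if x: "x \<in> PIdl e" for x
  proof -
    from x obtain r where r: "r \<in> carrier R" and x_eq: "x = r \<otimes> e"
      unfolding cgenideal_def by blast
    have "e \<otimes> (r \<otimes> e) = r \<otimes> (e \<otimes> e)"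
      by (rule m_lcomm[OF e(1) r e(1)])
    then show ?thesis
      unfolding x_eq e(2) .
  qed
  have abelian: "abelian_group (idempotent_ring R e)"
    by (rule abelian_groupI) (auto simp: idempotent_ring_def sub a_ac add zero neg)
  have monoid: "comm_monoid (idempotent_ring R e)"
    by (rule comm_monoidI)
       (auto simp: idempotent_ring_def sub m_assoc unit e' mult intro: m_comm)
  show ?thesis
    by (rule cringI[OF abelian monoid]) (auto simp: idempotent_ring_def sub l_distr add mult)
qed

context module
begin

lemma cring_trivial_extension: "cring (trivial_extension R M)"
proof (rule cringI)
  show "abelian_group (trivial_extension R M)"
    by (rule abelian_groupI)
       (auto simp: trivial_extension_def R.a_ac M.a_ac
         dest: abelian_groupE(6)[OF R.is_abelian_group] abelian_groupE(6)[OF M.abelian_group_axioms])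
  show "comm_monoid (trivial_extension R M)"
    by (rule comm_monoidI)
       (auto simp: trivial_extension_def R.m_ac smult_r_distr smult_assoc1[symmetric] M.a_ac)
qed (auto simp: trivial_extension_def R.l_distr smult_l_distr smult_r_distr M.a_ac)

lemma module_direct_sum:
  assumes "module R N"
  shows "module R (direct_sum M N)"
proof -
  interpret N: module R N by fact
  show ?thesis
  proof (rule moduleI)
    show "abelian_group (direct_sum M N)"
      by (rule abelian_groupI)
         (auto simp: direct_sum_def RDirProd_def DirProd_def monoid.defs ring.defs
           M.a_ac N.a_ac
           dest: abelian_groupE(6)[OF M.abelian_group_axioms]
             abelian_groupE(6)[OF N.abelian_group_axioms])
  qed (auto simp: direct_sum_def RDirProd_def DirProd_def monoid.defs ring.defs R.is_cring
        smult_l_distr smult_r_distr smult_assoc1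
        N.smult_l_distr N.smult_r_distr N.smult_assoc1)
qed

lemma submodule_annihilator:
  "submodule (annihilator R M (carrier M)) R (regular_module R)"
proof -
  interpret A: module R "regular_module R"
    by (rule R.regular_module_module)
  have inv: "\<ominus>\<^bsub>regular_module R\<^esub> a = \<ominus>\<^bsub>R\<^esub> a" for a
    by (simp add: a_inv_def regular_module_def m_inv_def)
  show ?thesis
    by (rule A.submoduleI)
       (auto simp: annihilator_def inv,
        auto simp: regular_module_def smult_l_distr smult_l_minus smult_assoc1)
qed

lemma module_annihilator_module: "module R (annihilator_module R M)"
  unfolding annihilator_module_def
  by (rule submodule.submodule_is_module[OF submodule_annihilator R.regular_module_module])

end

end

theory Submission
  imports Defs
begin

text \<open>
  Write \<open>A\<close> for the trivial extension of \<open>R\<close> by \<open>M\<close>, \<open>I\<close> for the annihilator of \<open>M\<close>, and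
  \<open>P\<close> for the \<open>R\<close>-module \<open>M \<oplus> I\<close>. The proof rests on two observations.

  First, \<open>P\<close> sits inside \<open>A\<close>, as the ideal \<open>Q\<close> of all pairs \<open>(a, x)\<close> with \<open>a \<in> I\<close>. Since
  \<open>(r, y)(a, x) = (ra, rx + ay) = (ra, rx)\<close> there, the ring \<open>A\<close> acts on \<open>Q\<close> through \<open>R\<close>, so the
  submodules of \<open>P\<close> are exactly the ideals of \<open>A\<close> contained in \<open>Q\<close>. Moreover \<open>Q\<close> is essential
  in \<open>A\<close>: if \<open>ay \<noteq> 0\<close> for some \<open>y\<close>, then \<open>(a, x)(0, y) = (0, ay)\<close> is a nonzero multiple of
  \<open>(a, x)\<close> in \<open>Q\<close>. Properties that speak about essential submodules therefore pass between \<open>A\<close> and \<open>P\<close>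
  (\<open>CS_trivial_extension_imp_weakly_IN\<close> and \<open>strongly_CS_imp_CS_trivial_extension\<close>).

  Second, weakly IN and strongly CS coincide for a module whose annihilator is generated by an
  idempotent (\<open>strongly_CS_imp_weakly_IN\<close> and \<open>weakly_IN_imp_strongly_CS\<close>). Being weakly IN
  means that any two submodules with zero intersection are told apart by a scalar acting as the identity on
  one and as zero on the other. Applied to a pair of submodules each maximal among those disjoint from the
  other, this scalar turns out to be idempotent modulo the annihilator; the hypothesis on the annihilator
  serves to lift it to an idempotent of \<open>R\<close>. Without that hypothesis the implication fails: over
  the integers, \<open>\<int>/6\<close> is weakly IN but not strongly CS.

  Since the annihilator of a ring in itself is zero, a ring is CS if and only if it is weakly IN as a module
  over itself (\<open>CS_ring_iff_weakly_IN\<close>). If \<open>P\<close> is weakly IN, then the scalar that separates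
  its summands \<open>M\<close> and \<open>I\<close> is an idempotent generator \<open>e\<close> of \<open>I\<close>, and \<open>P\<close> is
  faithful, so that \<open>P\<close> is strongly CS. This closes the circle: \<open>P\<close> strongly CS, \<open>A\<close> CS, \<open>P\<close>
  weakly IN. Finally, such an \<open>e\<close> splits every submodule of \<open>P\<close> into a part in \<open>M\<close> and a
  part in \<open>I\<close>, so \<open>P\<close> is weakly IN if and only if \<open>M\<close> and \<open>I\<close> are
  (\<open>weakly_IN_direct_sum_iff\<close>), and for \<open>I = eR\<close> this is the CS property of the ring
  \<open>eR\<close> (\<open>CS_ring_idempotent_ring_iff\<close>).
\<close>

section \<open>Submodules and scalars\<close>

context module
begin

lemma submodule_iff:
  "submodule H R M \<longleftrightarrow> H \<subseteq> carrier M \<and> \<zero>\<^bsub>M\<^esub> \<in> H \<and> (\<forall>x\<in>H. \<forall>y\<in>H. x \<oplus>\<^bsub>M\<^esub> y \<in> H) \<and>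
     (\<forall>a\<in>carrier R. \<forall>x\<in>H. a \<odot>\<^bsub>M\<^esub> x \<in> H)"
proof
  assume H: "submodule H R M"
  then have "\<zero>\<^bsub>M\<^esub> \<in> H"
    using subgroup.one_closed[OF submodule.axioms(1)[OF H]] by simp
  then show "H \<subseteq> carrier M \<and> \<zero>\<^bsub>M\<^esub> \<in> H \<and> (\<forall>x\<in>H. \<forall>y\<in>H. x \<oplus>\<^bsub>M\<^esub> y \<in> H) \<and>
     (\<forall>a\<in>carrier R. \<forall>x\<in>H. a \<odot>\<^bsub>M\<^esub> x \<in> H)"
    using submoduleE[OF H] by blast
next
  assume *: "H \<subseteq> carrier M \<and> \<zero>\<^bsub>M\<^esub> \<in> H \<and> (\<forall>x\<in>H. \<forall>y\<in>H. x \<oplus>\<^bsub>M\<^esub> y \<in> H) \<and>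
     (\<forall>a\<in>carrier R. \<forall>x\<in>H. a \<odot>\<^bsub>M\<^esub> x \<in> H)"
  show "submodule H R M"
  proof (rule submoduleI)
    fix x assume x: "x \<in> H"
    then have "\<ominus>\<^bsub>M\<^esub> x = (\<ominus> \<one>) \<odot>\<^bsub>M\<^esub> x"
      using * by (subst smult_l_minus) auto
    then show "\<ominus>\<^bsub>M\<^esub> x \<in> H"
      using * x by simp
  qed (use * in auto)
qed

lemma submodule_sum:
  assumes "submodule N R M" "submodule L R M"
  shows "submodule (N <+>\<^bsub>M\<^esub> L) R M"
proof -
  note N = assms(1)[unfolded submodule_iff] and L = assms(2)[unfolded submodule_iff]
  show ?thesis
    unfolding submodule_iff
  proof (intro conjI ballI)
    show "N <+>\<^bsub>M\<^esub> L \<subseteq> carrier M"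
      using N L unfolding set_add_def' by blast
    show "\<zero>\<^bsub>M\<^esub> \<in> N <+>\<^bsub>M\<^esub> L"
      using N L unfolding set_add_def' by (force intro: M.l_zero[symmetric])
  next
    fix x y assume "x \<in> N <+>\<^bsub>M\<^esub> L" "y \<in> N <+>\<^bsub>M\<^esub> L"
    then obtain n l n' l' where *: "n \<in> N" "l \<in> L" "n' \<in> N" "l' \<in> L"
      "x = n \<oplus>\<^bsub>M\<^esub> l" "y = n' \<oplus>\<^bsub>M\<^esub> l'"
      unfolding set_add_def' by blast
    moreover have "n \<in> carrier M" "l \<in> carrier M" "n' \<in> carrier M" "l' \<in> carrier M"
      using * N L by auto
    ultimately have "x \<oplus>\<^bsub>M\<^esub> y = (n \<oplus>\<^bsub>M\<^esub> n') \<oplus>\<^bsub>M\<^esub> (l \<oplus>\<^bsub>M\<^esub> l')"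
      by (simp add: M.a_ac)
    then show "x \<oplus>\<^bsub>M\<^esub> y \<in> N <+>\<^bsub>M\<^esub> L"
      using * N L unfolding set_add_def' by blast
  next
    fix a x assume a: "a \<in> carrier R" and "x \<in> N <+>\<^bsub>M\<^esub> L"
    then obtain n l where *: "n \<in> N" "l \<in> L" "x = n \<oplus>\<^bsub>M\<^esub> l"
      unfolding set_add_def' by blast
    then have "a \<odot>\<^bsub>M\<^esub> x = a \<odot>\<^bsub>M\<^esub> n \<oplus>\<^bsub>M\<^esub> a \<odot>\<^bsub>M\<^esub> l"
      using a N L by (auto intro!: smult_r_distr)
    then show "a \<odot>\<^bsub>M\<^esub> x \<in> N <+>\<^bsub>M\<^esub> L"
      using a * N L unfolding set_add_def' by blast
  qed
qed

lemma submodule_Int: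
  assumes "submodule N R M" "submodule L R M"
  shows "submodule (N \<inter> L) R M"
  using assms unfolding submodule_iff by blast

lemma submodule_zero: "submodule {\<zero>\<^bsub>M\<^esub>} R M"
  unfolding submodule_iff by simp

lemma smult_commute:
  assumes "a \<in> carrier R" "b \<in> carrier R" "x \<in> carrier M"
  shows "a \<odot>\<^bsub>M\<^esub> (b \<odot>\<^bsub>M\<^esub> x) = b \<odot>\<^bsub>M\<^esub> (a \<odot>\<^bsub>M\<^esub> x)"
  using assms by (metis R.m_comm smult_assoc1)

lemma submodule_smult_image:
  assumes "a \<in> carrier R"
  shows "submodule ((\<lambda>x. a \<odot>\<^bsub>M\<^esub> x) ` carrier M) R M"
  unfolding submodule_iff
proof (intro conjI ballI)
  show "(\<odot>\<^bsub>M\<^esub>) a ` carrier M \<subseteq> carrier M" using assms by auto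
  show "\<zero>\<^bsub>M\<^esub> \<in> (\<odot>\<^bsub>M\<^esub>) a ` carrier M"
    using assms by (auto intro!: image_eqI[where x = "\<zero>\<^bsub>M\<^esub>"])
  show "x \<oplus>\<^bsub>M\<^esub> y \<in> (\<odot>\<^bsub>M\<^esub>) a ` carrier M"
    if "x \<in> (\<odot>\<^bsub>M\<^esub>) a ` carrier M" "y \<in> (\<odot>\<^bsub>M\<^esub>) a ` carrier M" for x y
    using that assms by (auto simp: smult_r_distr[symmetric])
  show "b \<odot>\<^bsub>M\<^esub> x \<in> (\<odot>\<^bsub>M\<^esub>) a ` carrier M"
    if "b \<in> carrier R" "x \<in> (\<odot>\<^bsub>M\<^esub>) a ` carrier M" for b x
    using that assms by (auto simp: smult_commute[of b a])
qed

lemma submodule_kernel_smult: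
  assumes "a \<in> carrier R"
  shows "submodule {x \<in> carrier M. a \<odot>\<^bsub>M\<^esub> x = \<zero>\<^bsub>M\<^esub>} R M"
  unfolding submodule_iff using assms
  by (auto simp: smult_r_distr smult_commute[of a])

lemma smult_one_minus_add:
  assumes "a \<in> carrier R" "x \<in> carrier M"
  shows "(\<one> \<ominus> a) \<odot>\<^bsub>M\<^esub> x \<oplus>\<^bsub>M\<^esub> a \<odot>\<^bsub>M\<^esub> x = x"
proof -
  have "(\<one> \<ominus> a) \<oplus> a = \<one>" using assms(1) by algebra
  then show ?thesis using assms by (simp flip: smult_l_distr)
qed

lemma smult_one_minus_fixed:
  assumes "a \<in> carrier R" "x \<in> carrier M" "a \<odot>\<^bsub>M\<^esub> x = x"
  shows "(\<one> \<ominus> a) \<odot>\<^bsub>M\<^esub> x = \<zero>\<^bsub>M\<^esub>"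
  using assms by (simp add: a_minus_def[of R] smult_l_distr smult_l_minus M.r_neg)

lemma smult_one_minus_killed:
  assumes "a \<in> carrier R" "x \<in> carrier M" "a \<odot>\<^bsub>M\<^esub> x = \<zero>\<^bsub>M\<^esub>"
  shows "(\<one> \<ominus> a) \<odot>\<^bsub>M\<^esub> x = x"
  using assms smult_one_minus_add[of a x] by simp

section \<open>Weakly IN and strongly CS modules\<close>

text \<open>
  Splitting \<open>1 = b + a\<close> with \<open>b\<close> killing \<open>N\<close> and \<open>a\<close> killing \<open>L\<close> amounts to giving \<open>a\<close> alone,
  because \<open>b = 1 - a\<close> kills \<open>N\<close> precisely when \<open>a\<close> fixes \<open>N\<close> pointwise. This is
  the form in which comaximality of annihilators is used from here on.
\<close>

lemma annihilators_comaximal_iff: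
  assumes N: "N \<subseteq> carrier M" and L: "L \<subseteq> carrier M"
  shows "annihilator R M N <+>\<^bsub>R\<^esub> annihilator R M L = carrier R \<longleftrightarrow>
    (\<exists>a\<in>carrier R. (\<forall>x\<in>N. a \<odot>\<^bsub>M\<^esub> x = x) \<and> (\<forall>x\<in>L. a \<odot>\<^bsub>M\<^esub> x = \<zero>\<^bsub>M\<^esub>))"
proof
  assume "annihilator R M N <+>\<^bsub>R\<^esub> annihilator R M L = carrier R"
  then have "\<one> \<in> annihilator R M N <+>\<^bsub>R\<^esub> annihilator R M L" by simp
  then obtain b a where b: "b \<in> annihilator R M N" and a: "a \<in> annihilator R M L"
    and one: "\<one> = b \<oplus> a"
    unfolding set_add_def' by blast
  have "a \<odot>\<^bsub>M\<^esub> x = x" if "x \<in> N" for x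
  proof -
    have "x = (b \<oplus> a) \<odot>\<^bsub>M\<^esub> x"
      using that N one by (metis smult_one subsetD)
    also have "\<dots> = a \<odot>\<^bsub>M\<^esub> x"
      using that N a b by (subst smult_l_distr) (auto simp: annihilator_def)
    finally show ?thesis by simp
  qed
  then show "\<exists>a\<in>carrier R. (\<forall>x\<in>N. a \<odot>\<^bsub>M\<^esub> x = x) \<and> (\<forall>x\<in>L. a \<odot>\<^bsub>M\<^esub> x = \<zero>\<^bsub>M\<^esub>)"
    using a unfolding annihilator_def by blast
next
  assume "\<exists>a\<in>carrier R. (\<forall>x\<in>N. a \<odot>\<^bsub>M\<^esub> x = x) \<and> (\<forall>x\<in>L. a \<odot>\<^bsub>M\<^esub> x = \<zero>\<^bsub>M\<^esub>)"
  then obtain a where a: "a \<in> carrier R" "\<And>x. x \<in> N \<Longrightarrow> a \<odot>\<^bsub>M\<^esub> x = x"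
    "\<And>x. x \<in> L \<Longrightarrow> a \<odot>\<^bsub>M\<^esub> x = \<zero>\<^bsub>M\<^esub>"
    by blast
  show "annihilator R M N <+>\<^bsub>R\<^esub> annihilator R M L = carrier R"
  proof
    show "annihilator R M N <+>\<^bsub>R\<^esub> annihilator R M L \<subseteq> carrier R"
      unfolding set_add_def' annihilator_def by auto
    show "carrier R \<subseteq> annihilator R M N <+>\<^bsub>R\<^esub> annihilator R M L"
    proof
      fix r assume r: "r \<in> carrier R"
      have "r \<otimes> (\<one> \<ominus> a) \<in> annihilator R M N"
        using r a N
        by (auto simp: annihilator_def smult_assoc1 smult_one_minus_fixed subset_iff)
      moreover have "r \<otimes> a \<in> annihilator R M L"
        using r a L by (auto simp: annihilator_def smult_assoc1 subset_iff)
      moreover have "r = r \<otimes> (\<one> \<ominus> a) \<oplus> r \<otimes> a"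
        using r a(1) by algebra
      ultimately show "r \<in> annihilator R M N <+>\<^bsub>R\<^esub> annihilator R M L"
        unfolding set_add_def' by blast
    qed
  qed
qed

lemma weakly_IN_module_iff:
  "weakly_IN_module R M \<longleftrightarrow>
    (\<forall>N L. submodule N R M \<longrightarrow> submodule L R M \<longrightarrow> N \<inter> L = {\<zero>\<^bsub>M\<^esub>} \<longrightarrow>
      (\<exists>a\<in>carrier R. (\<forall>x\<in>N. a \<odot>\<^bsub>M\<^esub> x = x) \<and> (\<forall>x\<in>L. a \<odot>\<^bsub>M\<^esub> x = \<zero>\<^bsub>M\<^esub>)))"
  unfolding weakly_IN_module_def
  using annihilators_comaximal_iff submoduleE(1) by (simp cong: imp_cong)

lemma weakly_IN_moduleD:
  assumes "weakly_IN_module R M" "submodule N R M" "submodule L R M" "N \<inter> L = {\<zero>\<^bsub>M\<^esub>}"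
  obtains a where "a \<in> carrier R" "\<And>x. x \<in> N \<Longrightarrow> a \<odot>\<^bsub>M\<^esub> x = x"
    "\<And>x. x \<in> L \<Longrightarrow> a \<odot>\<^bsub>M\<^esub> x = \<zero>\<^bsub>M\<^esub>"
  using assms unfolding weakly_IN_module_iff by metis

text \<open>
  An idempotent \<open>e\<close> decomposes the module as \<open>eM \<oplus> (1 - e)M\<close>; the second summand is represented as
  the kernel of multiplication by \<open>e\<close>.
\<close>

lemma strongly_CS_imp_CS:
  assumes "strongly_CS_module R M"
  shows "CS_module R M"
  unfolding CS_module_def
proof (intro allI impI)
  fix N assume "submodule N R M"
  then obtain e where e: "e \<in> carrier R" "e \<otimes> e = e"
    and ess: "essential_submodule R M N ((\<lambda>x. e \<odot>\<^bsub>M\<^esub> x) ` carrier M)"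
    using assms unfolding strongly_CS_module_def by metis
  let ?K = "(\<lambda>x. e \<odot>\<^bsub>M\<^esub> x) ` carrier M"
  let ?L = "{x \<in> carrier M. e \<odot>\<^bsub>M\<^esub> x = \<zero>\<^bsub>M\<^esub>}"
  have idem: "e \<odot>\<^bsub>M\<^esub> (e \<odot>\<^bsub>M\<^esub> x) = e \<odot>\<^bsub>M\<^esub> x" if "x \<in> carrier M" for x
    using that e smult_assoc1[of e e x] by simp
  have "direct_summand R M ?K"
    unfolding direct_summand_def
  proof (intro conjI exI)
    show "submodule ?K R M" "submodule ?L R M"
      using e submodule_smult_image submodule_kernel_smult by blast+
    show "?K \<inter> ?L = {\<zero>\<^bsub>M\<^esub>}"
    proof
      show "?K \<inter> ?L \<subseteq> {\<zero>\<^bsub>M\<^esub>}"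
        by (auto simp: idem)
      show "{\<zero>\<^bsub>M\<^esub>} \<subseteq> ?K \<inter> ?L"
        using e(1) by (auto intro!: image_eqI[where x = "\<zero>\<^bsub>M\<^esub>"])
    qed
    show "?K <+>\<^bsub>M\<^esub> ?L = carrier M"
    proof
      show "?K <+>\<^bsub>M\<^esub> ?L \<subseteq> carrier M"
        using e(1) unfolding set_add_def' by auto
      show "carrier M \<subseteq> ?K <+>\<^bsub>M\<^esub> ?L"
      proof
        fix x assume x: "x \<in> carrier M"
        have "x \<ominus>\<^bsub>M\<^esub> e \<odot>\<^bsub>M\<^esub> x \<in> ?L"
          using x e(1) by (simp add: a_minus_def smult_r_distr smult_r_minus idem M.r_neg)
        moreover have "x = e \<odot>\<^bsub>M\<^esub> x \<oplus>\<^bsub>M\<^esub> (x \<ominus>\<^bsub>M\<^esub> e \<odot>\<^bsub>M\<^esub> x)"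
          using x e(1) by (simp add: a_minus_def M.a_lcomm M.r_neg)
        ultimately show "x \<in> ?K <+>\<^bsub>M\<^esub> ?L"
          using x unfolding set_add_def' by blast
      qed
    qed
  qed
  with ess show "\<exists>K. direct_summand R M K \<and> essential_submodule R M N K"
    by blast
qed

text \<open>
  If \<open>N\<close> is essential in \<open>eM\<close>, then \<open>e\<close> is the identity on \<open>N\<close>. It kills every submodule
  \<open>L\<close> disjoint from \<open>N\<close>, because \<open>eL\<close> lies in \<open>L \<inter> eM\<close>, which meets \<open>N\<close> trivially
  and so vanishes.
\<close>

lemma strongly_CS_imp_weakly_IN:
  assumes "strongly_CS_module R M"
  shows "weakly_IN_module R M"
  unfolding weakly_IN_module_iff
proof (intro allI impI)
  fix N L assume N: "submodule N R M" and L: "submodule L R M" and NL: "N \<inter> L = {\<zero>\<^bsub>M\<^esub>}"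
  obtain e where e: "e \<in> carrier R" "e \<otimes> e = e"
    and ess: "essential_submodule R M N ((\<lambda>x. e \<odot>\<^bsub>M\<^esub> x) ` carrier M)"
    using assms N unfolding strongly_CS_module_def by metis
  let ?K = "(\<lambda>x. e \<odot>\<^bsub>M\<^esub> x) ` carrier M"
  have NK: "N \<subseteq> ?K" using ess unfolding essential_submodule_def by blast
  have "e \<odot>\<^bsub>M\<^esub> x = x" if "x \<in> N" for x
  proof -
    from that NK obtain y where "y \<in> carrier M" "x = e \<odot>\<^bsub>M\<^esub> y" by blast
    then show ?thesis using e smult_assoc1[of e e y] by simp
  qed
  moreover have "e \<odot>\<^bsub>M\<^esub> x = \<zero>\<^bsub>M\<^esub>" if x: "x \<in> L" for x
  proof -
    have sub: "submodule (L \<inter> ?K) R M"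
      using L e(1) submodule_Int submodule_smult_image by blast
    have "N \<inter> (L \<inter> ?K) = {\<zero>\<^bsub>M\<^esub>}"
      using NL NK by blast
    with sub ess have "L \<inter> ?K = {\<zero>\<^bsub>M\<^esub>}"
      unfolding essential_submodule_def by blast
    moreover have "e \<odot>\<^bsub>M\<^esub> x \<in> L \<inter> ?K"
      using x L e(1) unfolding submodule_iff by blast
    ultimately show ?thesis by blast
  qed
  ultimately show "\<exists>a\<in>carrier R. (\<forall>x\<in>N. a \<odot>\<^bsub>M\<^esub> x = x) \<and> (\<forall>x\<in>L. a \<odot>\<^bsub>M\<^esub> x = \<zero>\<^bsub>M\<^esub>)"
    using e(1) by blast
qed

text \<open>
  A maximal submodule among those meeting \<open>N\<close> trivially, known as an intersection complement. In
  general its sum with \<open>N\<close> is not the whole module, only an essential submodule.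
\<close>

definition complement_of :: "'c set \<Rightarrow> 'c set \<Rightarrow> bool"
  where "complement_of N L \<longleftrightarrow> submodule L R M \<and> N \<inter> L = {\<zero>\<^bsub>M\<^esub>} \<and>
    (\<forall>L'. submodule L' R M \<longrightarrow> L \<subseteq> L' \<longrightarrow> N \<inter> L' = {\<zero>\<^bsub>M\<^esub>} \<longrightarrow> L' = L)"

text \<open>
  Zorn's lemma; a chain of submodules has a submodule as its union. Prescribing a submodule \<open>H\<close> of
  the complement makes it possible to take a complement of a complement of \<open>N\<close> that contains \<open>N\<close>.
\<close>

lemma exists_complement:
  assumes H: "submodule H R M" and NH: "N \<inter> H = {\<zero>\<^bsub>M\<^esub>}"
  obtains L where "H \<subseteq> L" "complement_of N L"
proof -
  define \<A> where "\<A> = {L. submodule L R M \<and> H \<subseteq> L \<and> N \<inter> L = {\<zero>\<^bsub>M\<^esub>}}"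
  have memI: "L \<in> \<A>" if "submodule L R M" "H \<subseteq> L" "N \<inter> L = {\<zero>\<^bsub>M\<^esub>}" for L
    using that by (simp add: \<A>_def)
  have memD: "submodule L R M" "H \<subseteq> L" "N \<inter> L = {\<zero>\<^bsub>M\<^esub>}" if "L \<in> \<A>" for L
    using that by (simp_all add: \<A>_def)
  have "\<exists>L\<in>\<A>. \<forall>S\<in>\<A>. L \<subseteq> S \<longrightarrow> S = L"
  proof (rule subset_Zorn_nonempty)
    show "\<A> \<noteq> {}" using memI[OF H _ NH] by blast
  next
    fix C assume ne: "C \<noteq> {}" and chain: "subset.chain \<A> C"
    then have CA: "S \<in> \<A>" if "S \<in> C" for S
      using that unfolding subset.chain_def by blast
    have lin: "S \<subseteq> T \<or> T \<subseteq> S" if "S \<in> C" "T \<in> C" for S T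
      using chain that unfolding subset.chain_def by blast
    obtain S where S: "S \<in> C" using ne by blast
    show "\<Union>C \<in> \<A>"
    proof (rule memI)
      show "submodule (\<Union>C) R M"
        unfolding submodule_iff
      proof (intro conjI ballI)
        show "\<Union>C \<subseteq> carrier M"
          using submoduleE(1)[OF memD(1)[OF CA]] by (rule Union_least)
        show "\<zero>\<^bsub>M\<^esub> \<in> \<Union>C"
          using S memD(3)[OF CA[OF S]] by blast
      next
        fix x y assume "x \<in> \<Union>C" "y \<in> \<Union>C"
        then obtain S T where ST: "S \<in> C" "x \<in> S" "T \<in> C" "y \<in> T" by (elim UnionE)
        then obtain Z where Z: "Z \<in> C" "x \<in> Z" "y \<in> Z"
          using lin[OF ST(1,3)] by (metis subsetD)
        then show "x \<oplus>\<^bsub>M\<^esub> y \<in> \<Union>C"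
          using submoduleE(5)[OF memD(1)[OF CA[OF Z(1)]] Z(2,3)] by blast
      next
        fix a x assume a: "a \<in> carrier R" and "x \<in> \<Union>C"
        then obtain S where S: "S \<in> C" "x \<in> S" by (elim UnionE)
        then show "a \<odot>\<^bsub>M\<^esub> x \<in> \<Union>C"
          using submoduleE(4)[OF memD(1)[OF CA[OF S(1)]] a S(2)] by blast
      qed
      show "H \<subseteq> \<Union>C"
        using memD(2)[OF CA[OF S]] S by blast
      show "N \<inter> \<Union>C = {\<zero>\<^bsub>M\<^esub>}"
        using memD(3)[OF CA[OF S]] memD(3)[OF CA] S by (simp add: Int_Union) blast
    qed
  qed
  then obtain L where L: "L \<in> \<A>" and max: "\<And>S. S \<in> \<A> \<Longrightarrow> L \<subseteq> S \<Longrightarrow> S = L"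
    by metis
  have "complement_of N L"
    unfolding complement_of_def using memD[OF L] max memI by (meson subset_trans)
  with memD(2)[OF L] show thesis by (rule that)
qed

text \<open>
  The sum of a submodule and a complement of it is essential: if \<open>U\<close> meets \<open>N + L\<close> trivially, then
  \<open>U + L\<close> still meets \<open>N\<close> trivially, so \<open>U \<subseteq> L\<close> by maximality, and hence
  \<open>U = 0\<close>.
\<close>

lemma complement_sum_essential:
  assumes N: "submodule N R M" and L: "complement_of N L" and U: "submodule U R M"
    and zero: "\<And>n l. n \<in> N \<Longrightarrow> l \<in> L \<Longrightarrow> n \<oplus>\<^bsub>M\<^esub> l \<in> U \<Longrightarrow> n \<oplus>\<^bsub>M\<^esub> l = \<zero>\<^bsub>M\<^esub>"
  shows "U = {\<zero>\<^bsub>M\<^esub>}"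
proof -
  have Ls: "submodule L R M" and NL: "N \<inter> L = {\<zero>\<^bsub>M\<^esub>}"
    using L unfolding complement_of_def by blast+
  note mem = submoduleE(1)[OF N] submoduleE(1)[OF Ls] submoduleE(1)[OF U]
  have z: "\<zero>\<^bsub>M\<^esub> \<in> N" "\<zero>\<^bsub>M\<^esub> \<in> L" "\<zero>\<^bsub>M\<^esub> \<in> U"
    using N Ls U unfolding submodule_iff by blast+
  have sub: "L \<subseteq> U <+>\<^bsub>M\<^esub> L" "U \<subseteq> U <+>\<^bsub>M\<^esub> L"
  proof -
    have "l = \<zero>\<^bsub>M\<^esub> \<oplus>\<^bsub>M\<^esub> l" if "l \<in> L" for l using that mem by auto
    then show "L \<subseteq> U <+>\<^bsub>M\<^esub> L" using z unfolding set_add_def' by blast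
    have "u = u \<oplus>\<^bsub>M\<^esub> \<zero>\<^bsub>M\<^esub>" if "u \<in> U" for u using that mem by auto
    then show "U \<subseteq> U <+>\<^bsub>M\<^esub> L" using z unfolding set_add_def' by blast
  qed
  have "x = \<zero>\<^bsub>M\<^esub>" if x: "x \<in> N" "x \<in> U <+>\<^bsub>M\<^esub> L" for x
  proof -
    from x obtain u l where ul: "u \<in> U" "l \<in> L" "x = u \<oplus>\<^bsub>M\<^esub> l"
      unfolding set_add_def' by blast
    have c: "u \<in> carrier M" "l \<in> carrier M" using ul mem by auto
    then have "x \<oplus>\<^bsub>M\<^esub> (\<ominus>\<^bsub>M\<^esub> l) = u"
      using ul by (simp add: M.a_assoc M.r_neg)
    then have "u = \<zero>\<^bsub>M\<^esub>"
      using zero[OF x(1) submoduleE(3)[OF Ls ul(2)]] ul(1) by simp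
    then have "x \<in> N \<inter> L" using ul c x by simp
    then show ?thesis using NL by blast
  qed
  then have "N \<inter> (U <+>\<^bsub>M\<^esub> L) = {\<zero>\<^bsub>M\<^esub>}"
    using z sub by blast
  then have "U <+>\<^bsub>M\<^esub> L = L"
    using L sub submodule_sum[OF U Ls] unfolding complement_of_def by blast
  then have UL: "U \<subseteq> L" using sub by blast
  have "u = \<zero>\<^bsub>M\<^esub>" if "u \<in> U" for u
    using zero[of "\<zero>\<^bsub>M\<^esub>" u] that UL z mem by (simp add: subset_iff)
  then show ?thesis using z by blast
qed

text \<open>
  A submodule \<open>U\<close> of \<open>K\<close> that is disjoint from \<open>N\<close> is even disjoint from \<open>N + L\<close>: from
  \<open>n + l \<in> U\<close> it follows that \<open>l \<in> K \<inter> L = 0\<close>. Thus the previous lemma applies.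
\<close>

lemma essential_if_disjoint_from_complement:
  assumes N: "submodule N R M" and L: "complement_of N L"
    and K: "submodule K R M" "N \<subseteq> K" "L \<inter> K = {\<zero>\<^bsub>M\<^esub>}"
  shows "essential_submodule R M N K"
  unfolding essential_submodule_def
proof (intro conjI allI impI)
  fix U assume U: "submodule U R M" "U \<subseteq> K" "N \<inter> U = {\<zero>\<^bsub>M\<^esub>}"
  have Lc: "L \<subseteq> carrier M"
    using L submoduleE(1) unfolding complement_of_def by blast
  have Nc: "N \<subseteq> carrier M" using submoduleE(1)[OF N] .
  show "U = {\<zero>\<^bsub>M\<^esub>}"
  proof (rule complement_sum_essential[OF N L U(1)])
    fix n l assume nl: "n \<in> N" "l \<in> L" "n \<oplus>\<^bsub>M\<^esub> l \<in> U"
    have c: "n \<in> carrier M" "l \<in> carrier M" using nl Nc Lc by auto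
    have "(\<ominus>\<^bsub>M\<^esub> n) \<oplus>\<^bsub>M\<^esub> (n \<oplus>\<^bsub>M\<^esub> l) \<in> K"
      using nl U K submoduleE(3,5)[OF K(1)] by blast
    then have "l \<in> K"
      using c by (simp add: M.r_neg1)
    then have "l = \<zero>\<^bsub>M\<^esub>" using nl K by blast
    then show "n \<oplus>\<^bsub>M\<^esub> l = \<zero>\<^bsub>M\<^esub>" using nl U c by auto
  qed
qed (use N K in blast)+

text \<open>
  Take a complement \<open>L\<close> of \<open>N\<close> and a complement \<open>K\<close> of \<open>L\<close> containing \<open>N\<close>; then \<open>N\<close>
  is essential in \<open>K\<close>, and some \<open>b\<close> fixes \<open>K\<close> and kills \<open>L\<close>, while \<open>a = 1 - b\<close> does
  the opposite. The crux is that \<open>ab\<close> kills \<open>M\<close>. By maximality the kernel of \<open>b\<^sup>2\<close> is no larger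
  than \<open>L\<close>, and that of \<open>a\<^sup>2\<close> no larger than \<open>K\<close>, so an element killed by \<open>(ab)\<^sup>2\<close> is already killed
  by \<open>ab\<close>. As \<open>ab\<close> also kills \<open>K + L\<close>, the submodule \<open>abM\<close> meets \<open>K + L\<close> trivially, and
  it vanishes because \<open>N + L\<close> is essential. Hence \<open>b\<close> projects \<open>M\<close> onto \<open>K\<close>, and only a
  true idempotent with the same action remains to be found.
\<close>

lemma weakly_IN_imp_strongly_CS:
  assumes wIN: "weakly_IN_module R M"
    and e: "e \<in> carrier R" "e \<otimes> e = e" "annihilator R M (carrier M) = PIdl e"
  shows "strongly_CS_module R M"
  unfolding strongly_CS_module_def
proof (intro allI impI)
  fix N assume N: "submodule N R M"
  have "N \<inter> {\<zero>\<^bsub>M\<^esub>} = {\<zero>\<^bsub>M\<^esub>}" using N unfolding submodule_iff by blast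
  then obtain L where L: "complement_of N L"
    using exists_complement[OF submodule_zero] by blast
  then have Ls: "submodule L R M" and NL: "N \<inter> L = {\<zero>\<^bsub>M\<^esub>}"
    unfolding complement_of_def by blast+
  have "L \<inter> N = {\<zero>\<^bsub>M\<^esub>}" using NL by blast
  then obtain K where NK: "N \<subseteq> K" and K: "complement_of L K"
    using exists_complement[OF N] by blast
  then have Ks: "submodule K R M" and LK: "L \<inter> K = {\<zero>\<^bsub>M\<^esub>}"
    unfolding complement_of_def by blast+
  have ess: "essential_submodule R M N K"
    by (rule essential_if_disjoint_from_complement[OF N L Ks NK LK])
  have "K \<inter> L = {\<zero>\<^bsub>M\<^esub>}" using LK by blast
  then obtain b where b: "b \<in> carrier R" and bK: "\<And>x. x \<in> K \<Longrightarrow> b \<odot>\<^bsub>M\<^esub> x = x"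
    and bL: "\<And>x. x \<in> L \<Longrightarrow> b \<odot>\<^bsub>M\<^esub> x = \<zero>\<^bsub>M\<^esub>"
    using weakly_IN_moduleD[OF wIN Ks Ls] by blast
  define a where "a = \<one> \<ominus> b"
  have a: "a \<in> carrier R" using b by (simp add: a_def)
  note Kc = submoduleE(1)[OF Ks] and Lc = submoduleE(1)[OF Ls]
  have aK: "a \<odot>\<^bsub>M\<^esub> x = \<zero>\<^bsub>M\<^esub>" if "x \<in> K" for x
    using that b bK[OF that] Kc by (auto simp: a_def smult_one_minus_fixed)
  have aL: "a \<odot>\<^bsub>M\<^esub> x = x" if "x \<in> L" for x
    using that b bL[OF that] Lc by (auto simp: a_def smult_one_minus_killed)
  \<comment> \<open>Applied below with \<open>c = b\<close> and with \<open>c = a\<close>. The kernel of \<open>c\<^sup>2\<close> contains \<open>Y\<close> and still avoids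
     \<open>S\<close>, on which \<open>c\<close> is the identity, so it equals \<open>Y\<close> by maximality.\<close>
  have kernel: "{x \<in> carrier M. (c \<otimes> c) \<odot>\<^bsub>M\<^esub> x = \<zero>\<^bsub>M\<^esub>} = Y"
    if c: "c \<in> carrier R" and SY: "complement_of S Y" and S: "S \<subseteq> carrier M"
      and cS: "\<And>x. x \<in> S \<Longrightarrow> c \<odot>\<^bsub>M\<^esub> x = x" and cY: "\<And>x. x \<in> Y \<Longrightarrow> c \<odot>\<^bsub>M\<^esub> x = \<zero>\<^bsub>M\<^esub>" for c S Y
  proof -
    have Y: "submodule Y R M" "S \<inter> Y = {\<zero>\<^bsub>M\<^esub>}"
      using SY unfolding complement_of_def by blast+
    let ?Z = "{x \<in> carrier M. (c \<otimes> c) \<odot>\<^bsub>M\<^esub> x = \<zero>\<^bsub>M\<^esub>}"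
    have "submodule ?Z R M" using c by (intro submodule_kernel_smult) simp
    moreover have "Y \<subseteq> ?Z"
      using submoduleE(1)[OF Y(1)] c cY by (auto simp: smult_assoc1)
    moreover have "S \<inter> ?Z = {\<zero>\<^bsub>M\<^esub>}"
      using Y(2) c cS S \<open>Y \<subseteq> ?Z\<close> by (auto simp: smult_assoc1)
    ultimately show ?thesis using SY unfolding complement_of_def by blast
  qed
  have kerb: "{x \<in> carrier M. (b \<otimes> b) \<odot>\<^bsub>M\<^esub> x = \<zero>\<^bsub>M\<^esub>} = L"
    using kernel[OF b L submoduleE(1)[OF N]] bK bL NK by blast
  have kera: "{x \<in> carrier M. (a \<otimes> a) \<odot>\<^bsub>M\<^esub> x = \<zero>\<^bsub>M\<^esub>} = K"
    using kernel[OF a K Lc] aK aL by blast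
  let ?U = "(\<lambda>x. (a \<otimes> b) \<odot>\<^bsub>M\<^esub> x) ` carrier M"
  have "?U = {\<zero>\<^bsub>M\<^esub>}"
  proof (rule complement_sum_essential[OF N L])
    show "submodule ?U R M" using a b by (intro submodule_smult_image) simp
    fix n l assume nl: "n \<in> N" "l \<in> L" "n \<oplus>\<^bsub>M\<^esub> l \<in> ?U"
    then obtain m where m: "m \<in> carrier M" "n \<oplus>\<^bsub>M\<^esub> l = (a \<otimes> b) \<odot>\<^bsub>M\<^esub> m" by blast
    have c: "n \<in> carrier M" "l \<in> carrier M" "n \<in> K" using nl Lc NK Kc by auto
    have "(a \<otimes> b) \<odot>\<^bsub>M\<^esub> (n \<oplus>\<^bsub>M\<^esub> l) = \<zero>\<^bsub>M\<^esub>"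
      using a b c nl aK bL bK by (simp add: smult_r_distr smult_assoc1)
    then have "((a \<otimes> b) \<otimes> (a \<otimes> b)) \<odot>\<^bsub>M\<^esub> m = \<zero>\<^bsub>M\<^esub>"
      using m a b by (simp add: smult_assoc1)
    moreover have "(a \<otimes> b) \<otimes> (a \<otimes> b) = (b \<otimes> b) \<otimes> (a \<otimes> a)"
      using a b by algebra
    ultimately have "(a \<otimes> a) \<odot>\<^bsub>M\<^esub> m \<in> L"
      using a b m kerb by (auto simp: smult_assoc1)
    then have "b \<odot>\<^bsub>M\<^esub> ((a \<otimes> a) \<odot>\<^bsub>M\<^esub> m) = \<zero>\<^bsub>M\<^esub>" by (rule bL)
    then have "(a \<otimes> a) \<odot>\<^bsub>M\<^esub> (b \<odot>\<^bsub>M\<^esub> m) = \<zero>\<^bsub>M\<^esub>"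
      using a b m smult_commute[of b "a \<otimes> a" m] by simp
    then have "b \<odot>\<^bsub>M\<^esub> m \<in> K" using kera b m by blast
    then show "n \<oplus>\<^bsub>M\<^esub> l = \<zero>\<^bsub>M\<^esub>" using aK m a b by (simp add: smult_assoc1)
  qed
  then have ab: "a \<odot>\<^bsub>M\<^esub> (b \<odot>\<^bsub>M\<^esub> x) = \<zero>\<^bsub>M\<^esub>" if "x \<in> carrier M" for x
    using that a b by (auto simp flip: smult_assoc1)
  have bM: "b \<odot>\<^bsub>M\<^esub> x \<in> K" if "x \<in> carrier M" for x
    using that a b ab by (subst kera[symmetric]) (simp add: smult_assoc1)
  have "e \<in> annihilator R M (carrier M)"
    using e R.cgenideal_self by simp
  then have eM: "e \<odot>\<^bsub>M\<^esub> x = \<zero>\<^bsub>M\<^esub>" if "x \<in> carrier M" for x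
    using that unfolding annihilator_def by blast
  \<comment> \<open>Multiplying by \<open>1 - e\<close> leaves the action on \<open>M\<close> unchanged. It makes \<open>f\<close> idempotent because
     \<open>f\<^sup>2 - f\<close> annihilates \<open>M\<close>, hence lies in \<open>eR\<close>, while \<open>fe = 0\<close>.\<close>
  define f where "f = b \<otimes> (\<one> \<ominus> e)"
  have f: "f \<in> carrier R" using b e by (simp add: f_def)
  have fb: "f \<odot>\<^bsub>M\<^esub> x = b \<odot>\<^bsub>M\<^esub> x" if "x \<in> carrier M" for x
    using that b e(1) eM by (simp add: f_def smult_assoc1 smult_one_minus_killed)
  have fK: "f \<odot>\<^bsub>M\<^esub> x = x" if "x \<in> K" for x
    using that fb bK Kc by auto
  have "f \<otimes> f \<ominus> f \<in> annihilator R M (carrier M)"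
    unfolding annihilator_def using f fb[symmetric] fK bM b
    by (auto simp: a_minus_def smult_l_distr smult_l_minus smult_assoc1 M.r_neg)
  then obtain r where r: "r \<in> carrier R" "f \<otimes> f \<ominus> f = r \<otimes> e"
    using e unfolding cgenideal_def by blast
  have "f \<otimes> e = b \<otimes> (e \<ominus> e \<otimes> e)"
    unfolding f_def using b e(1) by algebra
  then have fe: "f \<otimes> e = \<zero>" using b e by (simp add: R.minus_eq R.r_neg)
  have "r \<otimes> e = r \<otimes> (e \<otimes> e)" using e by simp
  also have "\<dots> = (f \<otimes> f \<ominus> f) \<otimes> e" using r e by (simp add: R.m_assoc)
  also have "\<dots> = f \<otimes> (f \<otimes> e) \<ominus> f \<otimes> e" using f e(1) by algebra
  also have "\<dots> = \<zero>" using fe f by simp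
  finally have "f \<otimes> f = f" using r f by simp
  moreover have "(\<lambda>x. f \<odot>\<^bsub>M\<^esub> x) ` carrier M = K"
  proof (intro equalityI subsetI)
    fix x assume "x \<in> (\<lambda>x. f \<odot>\<^bsub>M\<^esub> x) ` carrier M"
    then show "x \<in> K" using fb bM by auto
  next
    fix x assume "x \<in> K"
    then show "x \<in> (\<lambda>x. f \<odot>\<^bsub>M\<^esub> x) ` carrier M"
      using fK[of x] Kc by (intro image_eqI[of _ _ x]) auto
  qed
  ultimately show "\<exists>e\<in>carrier R. e \<otimes> e = e \<and>
      essential_submodule R M N ((\<lambda>x. e \<odot>\<^bsub>M\<^esub> x) ` carrier M)"
    using f ess by blast
qed

lemma weakly_IN_iff_strongly_CS:
  assumes "CS_ring_direct_summand R (annihilator R M (carrier M))"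
  shows "weakly_IN_module R M \<longleftrightarrow> strongly_CS_module R M"
  using assms weakly_IN_imp_strongly_CS strongly_CS_imp_weakly_IN
  unfolding CS_ring_direct_summand_def by blast

end

section \<open>Operations of the derived modules and rings\<close>

lemma regular_module_simps [simp]:
  "carrier (regular_module R) = carrier R"
  "\<zero>\<^bsub>regular_module R\<^esub> = \<zero>\<^bsub>R\<^esub>"
  "x \<oplus>\<^bsub>regular_module R\<^esub> y = x \<oplus>\<^bsub>R\<^esub> y"
  "a \<odot>\<^bsub>regular_module R\<^esub> x = a \<otimes>\<^bsub>R\<^esub> x"
  by (simp_all add: regular_module_def)

lemma annihilator_module_simps [simp]:
  "carrier (annihilator_module R M) = annihilator R M (carrier M)"
  "\<zero>\<^bsub>annihilator_module R M\<^esub> = \<zero>\<^bsub>R\<^esub>"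
  "x \<oplus>\<^bsub>annihilator_module R M\<^esub> y = x \<oplus>\<^bsub>R\<^esub> y"
  "a \<odot>\<^bsub>annihilator_module R M\<^esub> x = a \<otimes>\<^bsub>R\<^esub> x"
  by (simp_all add: annihilator_module_def regular_module_def)

lemma direct_sum_simps [simp]:
  "carrier (direct_sum M N) = carrier M \<times> carrier N"
  "\<zero>\<^bsub>direct_sum M N\<^esub> = (\<zero>\<^bsub>M\<^esub>, \<zero>\<^bsub>N\<^esub>)"
  "(x, y) \<oplus>\<^bsub>direct_sum M N\<^esub> (x', y') = (x \<oplus>\<^bsub>M\<^esub> x', y \<oplus>\<^bsub>N\<^esub> y')"
  "a \<odot>\<^bsub>direct_sum M N\<^esub> (x, y) = (a \<odot>\<^bsub>M\<^esub> x, a \<odot>\<^bsub>N\<^esub> y)"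
  by (simp_all add: direct_sum_def RDirProd_def DirProd_def monoid.defs ring.defs)

lemma trivial_extension_simps [simp]:
  "carrier (trivial_extension R M) = carrier R \<times> carrier M"
  "\<zero>\<^bsub>trivial_extension R M\<^esub> = (\<zero>\<^bsub>R\<^esub>, \<zero>\<^bsub>M\<^esub>)"
  "(a, x) \<oplus>\<^bsub>trivial_extension R M\<^esub> (b, y) = (a \<oplus>\<^bsub>R\<^esub> b, x \<oplus>\<^bsub>M\<^esub> y)"
  "(a, x) \<otimes>\<^bsub>trivial_extension R M\<^esub> (b, y) =
     (a \<otimes>\<^bsub>R\<^esub> b, a \<odot>\<^bsub>M\<^esub> y \<oplus>\<^bsub>M\<^esub> b \<odot>\<^bsub>M\<^esub> x)"
  by (simp_all add: trivial_extension_def)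

section \<open>CS rings\<close>

context cring
begin

text \<open>
  A direct summand \<open>K\<close> of \<open>R\<close> is generated by the component \<open>k\<close> of \<open>1\<close> in \<open>K\<close>, which is the
  identity on \<open>K\<close>. If \<open>N\<close> is essential in \<open>K\<close> and \<open>L\<close> is disjoint from \<open>N\<close>, then \<open>k\<close>
  kills \<open>L\<close>, because \<open>kL \<subseteq> K \<inter> L = 0\<close>.
\<close>

lemma CS_ring_imp_weakly_IN:
  assumes "CS_ring R"
  shows "weakly_IN_module R (regular_module R)"
proof -
  interpret A: module R "regular_module R" by (rule regular_module_module)
  show ?thesis
    unfolding A.weakly_IN_module_iff
  proof (intro allI impI)
    fix N L assume N: "submodule N R (regular_module R)" and L: "submodule L R (regular_module R)"
      and NL: "N \<inter> L = {\<zero>\<^bsub>regular_module R\<^esub>}"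
    obtain K where K: "direct_summand R (regular_module R) K"
      and ess: "essential_submodule R (regular_module R) N K"
      using assms N unfolding CS_ring_def CS_module_def by blast
    have Ks: "submodule K R (regular_module R)" and NK: "N \<subseteq> K"
      using ess unfolding essential_submodule_def by blast+
    obtain K' where K': "submodule K' R (regular_module R)" "K \<inter> K' = {\<zero>}"
      "K <+>\<^bsub>regular_module R\<^esub> K' = carrier R"
      using K unfolding direct_summand_def by auto
    have "\<one> \<in> K <+>\<^bsub>regular_module R\<^esub> K'"
      using K'(3) by simp
    then obtain k k' where k: "k \<in> K" "k' \<in> K'" "\<one> = k \<oplus> k'"
      unfolding set_add_def' by auto
    note Kx = Ks[unfolded A.submodule_iff, simplified]
      and K'x = K'(1)[unfolded A.submodule_iff, simplified]
      and Lx = L[unfolded A.submodule_iff, simplified]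
    have kc: "k \<in> carrier R" "k' \<in> carrier R" using k Kx K'x by auto
    have "k \<otimes> x = x" if x: "x \<in> K" for x
    proof -
      have xc: "x \<in> carrier R" using x Kx by blast
      have "k' \<otimes> x \<in> K" using x kc Kx by blast
      moreover have "x \<otimes> k' \<in> K'" using xc k K'x by blast
      ultimately have "k' \<otimes> x = \<zero>" using K'(2) m_comm[OF xc kc(2)] by auto
      moreover have "(k \<oplus> k') \<otimes> x = x" using k(3)[symmetric] xc by simp
      ultimately show ?thesis using kc xc by (simp add: l_distr)
    qed
    moreover have "k \<otimes> x = \<zero>" if x: "x \<in> L" for x
    proof -
      have xc: "x \<in> carrier R" using x Lx by blast
      have "submodule (L \<inter> K) R (regular_module R)"
        using A.submodule_Int L Ks by blast
      moreover have "N \<inter> (L \<inter> K) = {\<zero>}" using NL NK by auto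
      ultimately have "L \<inter> K = {\<zero>}"
        using ess unfolding essential_submodule_def by auto
      moreover have "k \<otimes> x \<in> L" "x \<otimes> k \<in> K" using x xc k kc Lx Kx by blast+
      ultimately show ?thesis using m_comm[OF xc kc(1)] by auto
    qed
    ultimately show "\<exists>a\<in>carrier R. (\<forall>x\<in>N. a \<odot>\<^bsub>regular_module R\<^esub> x = x) \<and>
        (\<forall>x\<in>L. a \<odot>\<^bsub>regular_module R\<^esub> x = \<zero>\<^bsub>regular_module R\<^esub>)"
      using NK kc by auto
  qed
qed

lemma PIdl_zero: "PIdl \<zero> = {\<zero>}"
  unfolding cgenideal_def by (auto intro: exI[of _ \<zero>])

text \<open>
  The regular module is faithful, so its annihilator is generated by the idempotent \<open>0\<close> and weakly IN
  implies strongly CS.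
\<close>

lemma CS_ring_iff_weakly_IN:
  "CS_ring R \<longleftrightarrow> weakly_IN_module R (regular_module R)"
proof
  assume wIN: "weakly_IN_module R (regular_module R)"
  interpret A: module R "regular_module R" by (rule regular_module_module)
  have "annihilator R (regular_module R) (carrier (regular_module R)) = {\<zero>}"
    unfolding annihilator_def by (auto dest: bspec[of _ _ \<one>])
  then have "strongly_CS_module R (regular_module R)"
    using A.weakly_IN_imp_strongly_CS[OF wIN, of \<zero>] PIdl_zero by simp
  then show "CS_ring R"
    unfolding CS_ring_def by (rule A.strongly_CS_imp_CS)
qed (rule CS_ring_imp_weakly_IN)

lemma mem_PIdl_idempotent_iff:
  assumes "e \<in> carrier R" "e \<otimes> e = e"
  shows "x \<in> PIdl e \<longleftrightarrow> x \<in> carrier R \<and> e \<otimes> x = x"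
  using assms unfolding cgenideal_def by (auto simp: m_lcomm) (metis m_comm)

end

context module
begin

section \<open>The direct sum of a module and its annihilator\<close>

text \<open>
  The scalars \<open>1 - e\<close> and \<open>e\<close> act as the two projections, so every submodule of the direct sum is
  the product of its projections, and scalars that separate the projections can be glued.
\<close>

lemma weakly_IN_direct_sum_iff:
  assumes N: "module R N" and e: "e \<in> carrier R"
    and eM: "\<And>x. x \<in> carrier M \<Longrightarrow> e \<odot>\<^bsub>M\<^esub> x = \<zero>\<^bsub>M\<^esub>"
    and eN: "\<And>y. y \<in> carrier N \<Longrightarrow> e \<odot>\<^bsub>N\<^esub> y = y"
  shows "weakly_IN_module R (direct_sum M N) \<longleftrightarrow> weakly_IN_module R M \<and> weakly_IN_module R N"
proof -
  interpret N: module R N by fact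
  interpret P: module R "direct_sum M N" by (rule module_direct_sum[OF N])
  show ?thesis
  proof (intro iffI conjI)
    assume wIN: "weakly_IN_module R (direct_sum M N)"
    show "weakly_IN_module R M"
      unfolding weakly_IN_module_iff
    proof (intro allI impI)
      fix U V assume U: "submodule U R M" and V: "submodule V R M" and UV: "U \<inter> V = {\<zero>\<^bsub>M\<^esub>}"
      have "submodule (U \<times> {\<zero>\<^bsub>N\<^esub>}) R (direct_sum M N)" "submodule (V \<times> {\<zero>\<^bsub>N\<^esub>}) R (direct_sum M N)"
        using U V unfolding P.submodule_iff submodule_iff by auto
      moreover have "(U \<times> {\<zero>\<^bsub>N\<^esub>}) \<inter> (V \<times> {\<zero>\<^bsub>N\<^esub>}) = {\<zero>\<^bsub>direct_sum M N\<^esub>}"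
        using UV by auto
      ultimately obtain a where "a \<in> carrier R"
        "\<And>x. x \<in> U \<times> {\<zero>\<^bsub>N\<^esub>} \<Longrightarrow> a \<odot>\<^bsub>direct_sum M N\<^esub> x = x"
        "\<And>x. x \<in> V \<times> {\<zero>\<^bsub>N\<^esub>} \<Longrightarrow> a \<odot>\<^bsub>direct_sum M N\<^esub> x = \<zero>\<^bsub>direct_sum M N\<^esub>"
        using P.weakly_IN_moduleD[OF wIN] by metis
      then show "\<exists>a\<in>carrier R. (\<forall>x\<in>U. a \<odot>\<^bsub>M\<^esub> x = x) \<and> (\<forall>x\<in>V. a \<odot>\<^bsub>M\<^esub> x = \<zero>\<^bsub>M\<^esub>)"
        by fastforce
    qed
    show "weakly_IN_module R N"
      unfolding N.weakly_IN_module_iff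
    proof (intro allI impI)
      fix U V assume U: "submodule U R N" and V: "submodule V R N" and UV: "U \<inter> V = {\<zero>\<^bsub>N\<^esub>}"
      have "submodule ({\<zero>\<^bsub>M\<^esub>} \<times> U) R (direct_sum M N)" "submodule ({\<zero>\<^bsub>M\<^esub>} \<times> V) R (direct_sum M N)"
        using U V unfolding P.submodule_iff N.submodule_iff by auto
      moreover have "({\<zero>\<^bsub>M\<^esub>} \<times> U) \<inter> ({\<zero>\<^bsub>M\<^esub>} \<times> V) = {\<zero>\<^bsub>direct_sum M N\<^esub>}"
        using UV by auto
      ultimately obtain a where "a \<in> carrier R"
        "\<And>x. x \<in> {\<zero>\<^bsub>M\<^esub>} \<times> U \<Longrightarrow> a \<odot>\<^bsub>direct_sum M N\<^esub> x = x"
        "\<And>x. x \<in> {\<zero>\<^bsub>M\<^esub>} \<times> V \<Longrightarrow> a \<odot>\<^bsub>direct_sum M N\<^esub> x = \<zero>\<^bsub>direct_sum M N\<^esub>"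
        using P.weakly_IN_moduleD[OF wIN] by metis
      then show "\<exists>a\<in>carrier R. (\<forall>x\<in>U. a \<odot>\<^bsub>N\<^esub> x = x) \<and> (\<forall>x\<in>V. a \<odot>\<^bsub>N\<^esub> x = \<zero>\<^bsub>N\<^esub>)"
        by fastforce
    qed
  next
    assume wIN: "weakly_IN_module R M \<and> weakly_IN_module R N"
    have e'M: "(\<one> \<ominus> e) \<odot>\<^bsub>M\<^esub> x = x" if "x \<in> carrier M" for x
      using that e eM by (simp add: smult_one_minus_killed)
    have e'N: "(\<one> \<ominus> e) \<odot>\<^bsub>N\<^esub> y = \<zero>\<^bsub>N\<^esub>" if "y \<in> carrier N" for y
      using that e eN by (simp add: N.smult_one_minus_fixed)
    have fstW: "(x, \<zero>\<^bsub>N\<^esub>) \<in> W" and sndW: "(\<zero>\<^bsub>M\<^esub>, y) \<in> W"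
      if W: "submodule W R (direct_sum M N)" and xy: "(x, y) \<in> W" for W x y
    proof -
      have c: "x \<in> carrier M" "y \<in> carrier N" using P.submoduleE(1)[OF W] xy by auto
      have "(\<one> \<ominus> e) \<odot>\<^bsub>direct_sum M N\<^esub> (x, y) \<in> W" "e \<odot>\<^bsub>direct_sum M N\<^esub> (x, y) \<in> W"
        using P.submoduleE(4)[OF W _ xy] e by (blast intro: R.minus_closed R.one_closed)+
      then show "(x, \<zero>\<^bsub>N\<^esub>) \<in> W" "(\<zero>\<^bsub>M\<^esub>, y) \<in> W"
        using c by (simp_all add: e'M e'N eM eN)
    qed
    have proj: "submodule (fst ` W) R M" "submodule (snd ` W) R N"
      if W: "submodule W R (direct_sum M N)" for W
    proof -
      note Wx = W[unfolded P.submodule_iff]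
      have add: "(x \<oplus>\<^bsub>M\<^esub> x', y \<oplus>\<^bsub>N\<^esub> y') \<in> W" if "(x, y) \<in> W" "(x', y') \<in> W" for x y x' y'
        using Wx that by (metis direct_sum_simps(3))
      have sm: "(a \<odot>\<^bsub>M\<^esub> x, a \<odot>\<^bsub>N\<^esub> y) \<in> W" if "a \<in> carrier R" "(x, y) \<in> W" for a x y
        using Wx that by (metis direct_sum_simps(4))
      show "submodule (fst ` W) R M"
        unfolding submodule_iff
      proof (intro conjI ballI)
        show "fst ` W \<subseteq> carrier M" using Wx by auto
        show "\<zero>\<^bsub>M\<^esub> \<in> fst ` W" using Wx by (force intro: rev_image_eqI)
      next
        fix p q assume "p \<in> fst ` W" "q \<in> fst ` W"
        then obtain x y x' y' where W: "(x, y) \<in> W" "(x', y') \<in> W" "p = x" "q = x'" by force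
        show "p \<oplus>\<^bsub>M\<^esub> q \<in> fst ` W" using imageI[OF add[OF W(1,2)], of fst] W(3,4) by simp
      next
        fix a p assume a: "a \<in> carrier R" and "p \<in> fst ` W"
        then obtain x y where W: "(x, y) \<in> W" "p = x" by force
        show "a \<odot>\<^bsub>M\<^esub> p \<in> fst ` W" using imageI[OF sm[OF a W(1)], of fst] W(2) by simp
      qed
      show "submodule (snd ` W) R N"
        unfolding N.submodule_iff
      proof (intro conjI ballI)
        show "snd ` W \<subseteq> carrier N" using Wx by auto
        show "\<zero>\<^bsub>N\<^esub> \<in> snd ` W" using Wx by (force intro: rev_image_eqI)
      next
        fix p q assume "p \<in> snd ` W" "q \<in> snd ` W"
        then obtain x y x' y' where W: "(x, y) \<in> W" "(x', y') \<in> W" "p = y" "q = y'" by force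
        show "p \<oplus>\<^bsub>N\<^esub> q \<in> snd ` W" using imageI[OF add[OF W(1,2)], of snd] W(3,4) by simp
      next
        fix a p assume a: "a \<in> carrier R" and "p \<in> snd ` W"
        then obtain x y where W: "(x, y) \<in> W" "p = y" by force
        show "a \<odot>\<^bsub>N\<^esub> p \<in> snd ` W" using imageI[OF sm[OF a W(1)], of snd] W(2) by simp
      qed
    qed
    show "weakly_IN_module R (direct_sum M N)"
      unfolding P.weakly_IN_module_iff
    proof (intro allI impI)
      fix U V assume U: "submodule U R (direct_sum M N)" and V: "submodule V R (direct_sum M N)"
        and UV: "U \<inter> V = {\<zero>\<^bsub>direct_sum M N\<^esub>}"
      have z: "\<zero>\<^bsub>direct_sum M N\<^esub> \<in> U" "\<zero>\<^bsub>direct_sum M N\<^esub> \<in> V"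
        using UV by blast+
      have mem: "x \<in> carrier M \<and> y \<in> carrier N" if "(x, y) \<in> U \<union> V" for x y
        using that P.submoduleE(1)[OF U] P.submoduleE(1)[OF V] by auto
      have "fst ` U \<inter> fst ` V \<subseteq> {\<zero>\<^bsub>M\<^esub>}" "snd ` U \<inter> snd ` V \<subseteq> {\<zero>\<^bsub>N\<^esub>}"
        using UV fstW[OF U] fstW[OF V] sndW[OF U] sndW[OF V] by fastforce+
      then have M0: "fst ` U \<inter> fst ` V = {\<zero>\<^bsub>M\<^esub>}" and N0: "snd ` U \<inter> snd ` V = {\<zero>\<^bsub>N\<^esub>}"
        using z by force+
      obtain a where a: "a \<in> carrier R" "\<And>x. x \<in> fst ` U \<Longrightarrow> a \<odot>\<^bsub>M\<^esub> x = x"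
        "\<And>x. x \<in> fst ` V \<Longrightarrow> a \<odot>\<^bsub>M\<^esub> x = \<zero>\<^bsub>M\<^esub>"
        using weakly_IN_moduleD[OF _ proj(1)[OF U] proj(1)[OF V] M0] wIN by metis
      obtain b where b: "b \<in> carrier R" "\<And>y. y \<in> snd ` U \<Longrightarrow> b \<odot>\<^bsub>N\<^esub> y = y"
        "\<And>y. y \<in> snd ` V \<Longrightarrow> b \<odot>\<^bsub>N\<^esub> y = \<zero>\<^bsub>N\<^esub>"
        using N.weakly_IN_moduleD[OF _ proj(2)[OF U] proj(2)[OF V] N0] wIN by metis
      \<comment> \<open>This scalar acts as \<open>a\<close> on \<open>M\<close> and as \<open>b\<close> on \<open>N\<close>.\<close>
      define c where "c = a \<otimes> (\<one> \<ominus> e) \<oplus> b \<otimes> e"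
      have c: "c \<in> carrier R" using a b e by (simp add: c_def)
      have cxy: "c \<odot>\<^bsub>direct_sum M N\<^esub> (x, y) = (a \<odot>\<^bsub>M\<^esub> x, b \<odot>\<^bsub>N\<^esub> y)"
        if "x \<in> carrier M" "y \<in> carrier N" for x y
        using that a(1) b(1) e
        by (simp add: c_def smult_l_distr smult_assoc1 N.smult_l_distr N.smult_assoc1 e'M e'N eM eN)
      have "\<forall>x\<in>U. c \<odot>\<^bsub>direct_sum M N\<^esub> x = x"
      proof
        fix p assume p: "p \<in> U"
        obtain x y where xy: "p = (x, y)" by (cases p)
        have "x \<in> fst ` U" "y \<in> snd ` U"
          using imageI[OF p, of fst] imageI[OF p, of snd] xy by simp_all
        moreover have "x \<in> carrier M" "y \<in> carrier N" using mem p xy by blast+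
        ultimately show "c \<odot>\<^bsub>direct_sum M N\<^esub> p = p"
          using cxy[of x y] a(2)[of x] b(2)[of y] xy by simp
      qed
      moreover have "\<forall>x\<in>V. c \<odot>\<^bsub>direct_sum M N\<^esub> x = \<zero>\<^bsub>direct_sum M N\<^esub>"
      proof
        fix p assume p: "p \<in> V"
        obtain x y where xy: "p = (x, y)" by (cases p)
        have "x \<in> fst ` V" "y \<in> snd ` V"
          using imageI[OF p, of fst] imageI[OF p, of snd] xy by simp_all
        moreover have "x \<in> carrier M" "y \<in> carrier N" using mem p xy by blast+
        ultimately show "c \<odot>\<^bsub>direct_sum M N\<^esub> p = \<zero>\<^bsub>direct_sum M N\<^esub>"
          using cxy[of x y] a(3)[of x] b(3)[of y] xy by simp
      qed
      ultimately show "\<exists>a\<in>carrier R. (\<forall>x\<in>U. a \<odot>\<^bsub>direct_sum M N\<^esub> x = x) \<and>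
          (\<forall>x\<in>V. a \<odot>\<^bsub>direct_sum M N\<^esub> x = \<zero>\<^bsub>direct_sum M N\<^esub>)"
        using c by blast
    qed
  qed
qed

text \<open>
  On the ideal \<open>eR\<close> a scalar \<open>a\<close> of \<open>R\<close> acts in the same way as \<open>ea \<in> eR\<close>. Hence its submodules
  over \<open>R\<close> and its ideals as a ring coincide, and separating scalars can be taken from either ring.
\<close>

lemma CS_ring_idempotent_ring_iff:
  assumes e: "e \<in> carrier R" "e \<otimes> e = e" and ann: "annihilator R M (carrier M) = PIdl e"
  shows "CS_ring (idempotent_ring R e) \<longleftrightarrow> weakly_IN_module R (annihilator_module R M)"
proof -
  let ?E = "idempotent_ring R e"
  interpret I: module R "annihilator_module R M" by (rule module_annihilator_module)
  interpret E: cring ?E by (rule cring_idempotent_ring[OF e])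
  interpret EE: module ?E "regular_module ?E" by (rule E.regular_module_module)
  note memE = mem_PIdl_idempotent_iff[OF e]
  have Esimps: "carrier ?E = PIdl e" "\<zero>\<^bsub>?E\<^esub> = \<zero>" "\<And>x y. x \<oplus>\<^bsub>?E\<^esub> y = x \<oplus> y"
    "\<And>x y. x \<otimes>\<^bsub>?E\<^esub> y = x \<otimes> y"
    by (simp_all add: idempotent_ring_def)
  have restrict: "a \<otimes> x = (e \<otimes> a) \<otimes> x" if "a \<in> carrier R" "x \<in> PIdl e" for a x
    using that e by (metis memE R.m_assoc R.m_comm)
  have eE: "e \<otimes> a \<in> PIdl e" if "a \<in> carrier R" for a
    using that e by (simp add: memE flip: R.m_assoc)
  have sub: "submodule W ?E (regular_module ?E) \<longleftrightarrow> submodule W R (annihilator_module R M)" for W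
    unfolding EE.submodule_iff I.submodule_iff
  proof (simp add: Esimps ann, intro conj_cong refl iffI ballI)
    fix a x assume "W \<subseteq> PIdl e" "\<forall>a\<in>PIdl e. \<forall>x\<in>W. a \<otimes> x \<in> W" "a \<in> carrier R" "x \<in> W"
    then show "a \<otimes> x \<in> W" using eE[of a] restrict[of a x] by auto
  next
    fix a x assume "\<forall>a\<in>carrier R. \<forall>x\<in>W. a \<otimes> x \<in> W" "a \<in> PIdl e" "x \<in> W"
    then show "a \<otimes> x \<in> W" using memE by blast
  qed
  have exE: "(\<exists>a\<in>PIdl e. (\<forall>x\<in>N. a \<otimes> x = x) \<and> (\<forall>x\<in>L. a \<otimes> x = \<zero>)) \<longleftrightarrow>
      (\<exists>a\<in>carrier R. (\<forall>x\<in>N. a \<otimes> x = x) \<and> (\<forall>x\<in>L. a \<otimes> x = \<zero>))"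
    if "N \<subseteq> PIdl e" "L \<subseteq> PIdl e" for N L
  proof
    assume "\<exists>a\<in>carrier R. (\<forall>x\<in>N. a \<otimes> x = x) \<and> (\<forall>x\<in>L. a \<otimes> x = \<zero>)"
    then obtain a where "a \<in> carrier R" "\<forall>x\<in>N. a \<otimes> x = x" "\<forall>x\<in>L. a \<otimes> x = \<zero>" by blast
    then show "\<exists>a\<in>PIdl e. (\<forall>x\<in>N. a \<otimes> x = x) \<and> (\<forall>x\<in>L. a \<otimes> x = \<zero>)"
      using that restrict eE by (intro bexI[of _ "e \<otimes> a"]) (auto simp: subset_iff)
  qed (use memE in blast)
  have "CS_ring ?E \<longleftrightarrow> weakly_IN_module ?E (regular_module ?E)"
    by (rule E.CS_ring_iff_weakly_IN)
  also have "\<dots> \<longleftrightarrow> weakly_IN_module R (annihilator_module R M)"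
    unfolding EE.weakly_IN_module_iff I.weakly_IN_module_iff sub
    using exE I.submoduleE(1) by (simp add: Esimps ann cong: imp_cong)
  finally show ?thesis .
qed

text \<open>
  The summands \<open>M\<close> and \<open>Ann(M)\<close> are disjoint, so some \<open>e\<close> kills \<open>M\<close> and fixes
  \<open>Ann(M)\<close> pointwise. The former says that \<open>e\<close> is in \<open>Ann(M)\<close>; the latter then gives
  \<open>e\<^sup>2 = e\<close> and \<open>Ann(M) = eR\<close>.
\<close>

lemma annihilator_eq_PIdl_if_direct_sum_weakly_IN:
  assumes "weakly_IN_module R (direct_sum M (annihilator_module R M))"
  obtains e where "e \<in> carrier R" "e \<otimes> e = e" "annihilator R M (carrier M) = PIdl e"
proof -
  let ?I = "annihilator_module R M" and ?P = "direct_sum M (annihilator_module R M)"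
  interpret I: module R ?I by (rule module_annihilator_module)
  interpret P: module R ?P by (rule module_direct_sum[OF module_annihilator_module])
  let ?N = "{\<zero>\<^bsub>M\<^esub>} \<times> annihilator R M (carrier M)" and ?L = "carrier M \<times> {\<zero>}"
  have z: "\<zero> \<in> annihilator R M (carrier M)" using I.zero_closed by simp
  have "submodule ?N R ?P" "submodule ?L R ?P"
    unfolding P.submodule_iff using I.carrier_is_submodule[unfolded I.submodule_iff] z by auto
  moreover have "?N \<inter> ?L = {\<zero>\<^bsub>?P\<^esub>}"
    using z by auto
  ultimately obtain e where e: "e \<in> carrier R" "\<And>p. p \<in> ?N \<Longrightarrow> e \<odot>\<^bsub>?P\<^esub> p = p"
    "\<And>p. p \<in> ?L \<Longrightarrow> e \<odot>\<^bsub>?P\<^esub> p = \<zero>\<^bsub>?P\<^esub>"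
    using P.weakly_IN_moduleD[OF assms] by metis
  have eM: "e \<odot>\<^bsub>M\<^esub> x = \<zero>\<^bsub>M\<^esub>" if "x \<in> carrier M" for x
    using e(3)[of "(x, \<zero>)"] that by simp
  have eI: "e \<otimes> a = a" if "a \<in> annihilator R M (carrier M)" for a
    using e(2)[of "(\<zero>\<^bsub>M\<^esub>, a)"] that by simp
  have eann: "e \<in> annihilator R M (carrier M)"
    using e(1) eM unfolding annihilator_def by blast
  then have idem: "e \<otimes> e = e" by (rule eI)
  have "annihilator R M (carrier M) = PIdl e"
  proof (intro equalityI subsetI)
    fix a assume "a \<in> annihilator R M (carrier M)"
    then show "a \<in> PIdl e"
      using eI unfolding mem_PIdl_idempotent_iff[OF e(1) idem] by (auto simp: annihilator_def)
  next
    fix a assume "a \<in> PIdl e"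
    then show "a \<in> annihilator R M (carrier M)"
      using e(1) eM unfolding cgenideal_def annihilator_def by (auto simp: smult_assoc1)
  qed
  with e(1) idem show thesis by (rule that)
qed

text \<open>
  An element \<open>r\<close> killing \<open>M\<close> lies in \<open>eR\<close>, so \<open>r = er\<close>; if it kills \<open>e \<in> Ann(M)\<close> too,
  then it is zero.
\<close>

lemma direct_sum_annihilator_faithful:
  assumes e: "e \<in> carrier R" "e \<otimes> e = e" "annihilator R M (carrier M) = PIdl e"
  shows "annihilator R (direct_sum M (annihilator_module R M))
    (carrier (direct_sum M (annihilator_module R M))) = {\<zero>}"
proof (intro equalityI subsetI)
  let ?P = "direct_sum M (annihilator_module R M)"
  interpret I: module R "annihilator_module R M" by (rule module_annihilator_module)
  have z: "\<zero> \<in> annihilator R M (carrier M)" using I.zero_closed by simp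
  fix r assume r: "r \<in> annihilator R ?P (carrier ?P)"
  then have rc: "r \<in> carrier R"
    and kill: "\<And>x a. x \<in> carrier M \<Longrightarrow> a \<in> annihilator R M (carrier M) \<Longrightarrow>
      r \<odot>\<^bsub>M\<^esub> x = \<zero>\<^bsub>M\<^esub> \<and> r \<otimes> a = \<zero>"
    unfolding annihilator_def[of R ?P] by auto
  have "r \<in> annihilator R M (carrier M)"
    using rc kill[OF _ z] unfolding annihilator_def by blast
  then have "e \<otimes> r = r" using mem_PIdl_idempotent_iff[OF e(1,2)] e(3) by simp
  moreover have "r \<otimes> e = \<zero>"
    using kill[of "\<zero>\<^bsub>M\<^esub>" e] R.cgenideal_self[OF e(1)] e(3) by simp
  ultimately show "r \<in> {\<zero>}" using rc e(1) by (simp add: R.m_comm)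
next
  interpret P: module R "direct_sum M (annihilator_module R M)"
    by (rule module_direct_sum[OF module_annihilator_module])
  fix r assume "r \<in> {\<zero>}"
  then show "r \<in> annihilator R (direct_sum M (annihilator_module R M))
    (carrier (direct_sum M (annihilator_module R M)))"
    unfolding annihilator_def[of R "direct_sum M (annihilator_module R M)"]
    using P.smult_l_null by blast
qed

lemma weakly_IN_imp_strongly_CS_direct_sum_annihilator:
  assumes "weakly_IN_module R (direct_sum M (annihilator_module R M))"
  shows "strongly_CS_module R (direct_sum M (annihilator_module R M))"
proof -
  interpret P: module R "direct_sum M (annihilator_module R M)"
    by (rule module_direct_sum[OF module_annihilator_module])
  obtain e where e: "e \<in> carrier R" "e \<otimes> e = e" "annihilator R M (carrier M) = PIdl e"
    using annihilator_eq_PIdl_if_direct_sum_weakly_IN[OF assms] .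
  show ?thesis
    using P.weakly_IN_imp_strongly_CS[OF assms, of \<zero>] direct_sum_annihilator_faithful[OF e]
      R.PIdl_zero by simp
qed

lemma weakly_IN_direct_sum_annihilator_iff:
  "weakly_IN_module R (direct_sum M (annihilator_module R M)) \<longleftrightarrow>
    CS_ring_direct_summand R (annihilator R M (carrier M)) \<and> weakly_IN_module R M"
proof -
  let ?I = "annihilator_module R M" and ?P = "direct_sum M (annihilator_module R M)"
  have *: "weakly_IN_module R ?P \<longleftrightarrow> weakly_IN_module R M \<and> CS_ring (idempotent_ring R e)"
    if e: "e \<in> carrier R" "e \<otimes> e = e" "annihilator R M (carrier M) = PIdl e" for e
  proof -
    have "e \<in> annihilator R M (carrier M)" using R.cgenideal_self[OF e(1)] e(3) by simp
    then have "\<And>x. x \<in> carrier M \<Longrightarrow> e \<odot>\<^bsub>M\<^esub> x = \<zero>\<^bsub>M\<^esub>" unfolding annihilator_def by blast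
    moreover have "e \<odot>\<^bsub>?I\<^esub> a = a" if "a \<in> carrier ?I" for a
      using that mem_PIdl_idempotent_iff[OF e(1,2)] e(3) by simp
    ultimately show ?thesis
      using weakly_IN_direct_sum_iff[OF module_annihilator_module e(1)]
        CS_ring_idempotent_ring_iff[OF e] by simp
  qed
  show ?thesis
    using * annihilator_eq_PIdl_if_direct_sum_weakly_IN unfolding CS_ring_direct_summand_def by metis
qed

section \<open>The trivial extension\<close>

text \<open>
  Swapping components turns submodules of \<open>M \<oplus> Ann(M)\<close> into ideals of the trivial extension, on
  which \<open>(r, y)\<close> acts as \<open>r\<close> does. The first component of a separating element of the trivial extension is
  therefore a separating scalar.
\<close>

lemma CS_trivial_extension_imp_weakly_IN:
  assumes "CS_ring (trivial_extension R M)"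
  shows "weakly_IN_module R (direct_sum M (annihilator_module R M))"
proof -
  let ?A = "trivial_extension R M" and ?P = "direct_sum M (annihilator_module R M)"
  interpret P: module R ?P by (rule module_direct_sum[OF module_annihilator_module])
  interpret A: cring ?A by (rule cring_trivial_extension)
  interpret AA: module ?A "regular_module ?A" by (rule A.regular_module_module)
  have wIN: "weakly_IN_module ?A (regular_module ?A)"
    using assms by (rule A.CS_ring_imp_weakly_IN)
  have annD: "a \<in> carrier R" "\<And>y. y \<in> carrier M \<Longrightarrow> a \<odot>\<^bsub>M\<^esub> y = \<zero>\<^bsub>M\<^esub>"
    if "a \<in> annihilator R M (carrier M)" for a
    using that unfolding annihilator_def by auto
  have ideal: "submodule (prod.swap ` W) ?A (regular_module ?A)" if W: "submodule W R ?P" for W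
  proof -
    note Wx = W[unfolded P.submodule_iff]
    have mem: "x \<in> carrier M" "a \<in> annihilator R M (carrier M)" if "(x, a) \<in> W" for x a
      using Wx that by auto
    have add: "(x \<oplus>\<^bsub>M\<^esub> x', a \<oplus> a') \<in> W" if "(x, a) \<in> W" "(x', a') \<in> W" for x a x' a'
      using Wx that by (metis direct_sum_simps(3) annihilator_module_simps(3))
    have sm: "(r \<odot>\<^bsub>M\<^esub> x, r \<otimes> a) \<in> W" if "r \<in> carrier R" "(x, a) \<in> W" for r x a
      using Wx that by (metis direct_sum_simps(4) annihilator_module_simps(4))
    show ?thesis
      unfolding AA.submodule_iff
    proof (intro conjI ballI)
      show "prod.swap ` W \<subseteq> carrier (regular_module ?A)"
        using mem annD(1) by auto
      show "\<zero>\<^bsub>regular_module ?A\<^esub> \<in> prod.swap ` W"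
        using Wx by (auto intro!: rev_image_eqI)
      show "p \<oplus>\<^bsub>regular_module ?A\<^esub> q \<in> prod.swap ` W"
        if pq: "p \<in> prod.swap ` W" "q \<in> prod.swap ` W" for p q
      proof -
        obtain x a x' a' where xa: "p = (a, x)" "(x, a) \<in> W" "q = (a', x')" "(x', a') \<in> W"
          using pq by auto
        show ?thesis using imageI[OF add[OF xa(2,4)], of prod.swap] xa(1,3) by simp
      qed
      show "s \<odot>\<^bsub>regular_module ?A\<^esub> p \<in> prod.swap ` W"
        if s: "s \<in> carrier ?A" and p: "p \<in> prod.swap ` W" for s p
      proof -
        obtain r y where ry: "s = (r, y)" "r \<in> carrier R" "y \<in> carrier M" using s by auto
        obtain x a where xa: "p = (a, x)" "(x, a) \<in> W" using p by auto
        have "s \<odot>\<^bsub>regular_module ?A\<^esub> p = prod.swap (r \<odot>\<^bsub>M\<^esub> x, r \<otimes> a)"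
          using ry xa mem annD by simp
        then show ?thesis using sm[OF ry(2) xa(2)] by blast
      qed
    qed
  qed
  show ?thesis
    unfolding P.weakly_IN_module_iff
  proof (intro allI impI)
    fix U V assume U: "submodule U R ?P" and V: "submodule V R ?P" and UV: "U \<inter> V = {\<zero>\<^bsub>?P\<^esub>}"
    have "prod.swap ` U \<inter> prod.swap ` V = prod.swap ` (U \<inter> V)"
      by (simp add: image_Int)
    then have "prod.swap ` U \<inter> prod.swap ` V = {\<zero>\<^bsub>regular_module ?A\<^esub>}"
      using UV by simp
    then obtain s where s: "s \<in> carrier ?A"
      "\<And>p. p \<in> prod.swap ` U \<Longrightarrow> s \<odot>\<^bsub>regular_module ?A\<^esub> p = p"
      "\<And>p. p \<in> prod.swap ` V \<Longrightarrow> s \<odot>\<^bsub>regular_module ?A\<^esub> p = \<zero>\<^bsub>regular_module ?A\<^esub>"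
      using AA.weakly_IN_moduleD[OF wIN ideal[OF U] ideal[OF V]] by metis
    obtain r y where ry: "s = (r, y)" "r \<in> carrier R" "y \<in> carrier M" using s(1) by auto
    have swap: "s \<odot>\<^bsub>regular_module ?A\<^esub> prod.swap p = prod.swap (r \<odot>\<^bsub>?P\<^esub> p)"
      if "p \<in> carrier ?P" for p
      using that ry annD by auto
    have "r \<odot>\<^bsub>?P\<^esub> p = p" if "p \<in> U" for p
    proof -
      have "prod.swap (r \<odot>\<^bsub>?P\<^esub> p) = prod.swap p"
        using swap s(2)[of "prod.swap p"] that P.submoduleE(1)[OF U] by auto
      then show ?thesis by (metis swap_swap)
    qed
    moreover have "r \<odot>\<^bsub>?P\<^esub> p = \<zero>\<^bsub>?P\<^esub>" if "p \<in> V" for p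
    proof -
      have "prod.swap (r \<odot>\<^bsub>?P\<^esub> p) = prod.swap \<zero>\<^bsub>?P\<^esub>"
        using swap[of p] s(3)[of "prod.swap p"] that P.submoduleE(1)[OF V] by auto
      then show ?thesis by (metis swap_swap)
    qed
    ultimately show "\<exists>a\<in>carrier R. (\<forall>x\<in>U. a \<odot>\<^bsub>?P\<^esub> x = x) \<and> (\<forall>x\<in>V. a \<odot>\<^bsub>?P\<^esub> x = \<zero>\<^bsub>?P\<^esub>)"
      using ry by blast
  qed
qed

text \<open>
  Restrict an ideal \<open>J\<close> of the trivial extension to its trace on \<open>M \<oplus> Ann(M)\<close>. This loses nothing as
  far as essentiality is concerned, since an ideal with zero trace is zero. If the trace is essential in
  \<open>h(M \<oplus> Ann(M))\<close>, then \<open>J\<close> is essential in the ideal generated by the idempotent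
  \<open>(h, 0)\<close>.
\<close>

lemma strongly_CS_imp_CS_trivial_extension:
  assumes "strongly_CS_module R (direct_sum M (annihilator_module R M))"
  shows "CS_ring (trivial_extension R M)"
proof -
  let ?A = "trivial_extension R M" and ?P = "direct_sum M (annihilator_module R M)"
  let ?AA = "regular_module ?A"
  interpret I: module R "annihilator_module R M" by (rule module_annihilator_module)
  interpret P: module R ?P by (rule module_direct_sum[OF module_annihilator_module])
  interpret A: cring ?A by (rule cring_trivial_extension)
  interpret AA: module ?A ?AA by (rule A.regular_module_module)
  have annD: "a \<in> carrier R" "\<And>y. y \<in> carrier M \<Longrightarrow> a \<odot>\<^bsub>M\<^esub> y = \<zero>\<^bsub>M\<^esub>"
    if "a \<in> annihilator R M (carrier M)" for a
    using that unfolding annihilator_def by auto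
  have z: "\<zero> \<in> annihilator R M (carrier M)" using I.zero_closed by simp
  define trace where "trace J = {(x, a). (a, x) \<in> J \<and> a \<in> annihilator R M (carrier M)}"
    for J :: "('a \<times> 'c) set"
  have memJ: "a \<in> carrier R" "x \<in> carrier M" if "submodule J ?A ?AA" "(a, x) \<in> J" for J a x
    using AA.submoduleE(1)[OF that(1)] that(2) by auto
  have mult: "(r \<otimes> a, r \<odot>\<^bsub>M\<^esub> x \<oplus>\<^bsub>M\<^esub> a \<odot>\<^bsub>M\<^esub> y) \<in> J"
    if "submodule J ?A ?AA" "(a, x) \<in> J" "r \<in> carrier R" "y \<in> carrier M" for J a x r y
    using AA.submoduleE(4)[OF that(1), of "(r, y)" "(a, x)"] that by simp
  have mult0: "(r \<otimes> a, r \<odot>\<^bsub>M\<^esub> x) \<in> J"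
    if "submodule J ?A ?AA" "(a, x) \<in> J" "r \<in> carrier R" for J a x r
    using mult[OF that, of "\<zero>\<^bsub>M\<^esub>"] memJ[OF that(1,2)] that by simp
  have trace: "submodule (trace J) R ?P" if J: "submodule J ?A ?AA" for J
  proof -
    note Ix = I.carrier_is_submodule[unfolded I.submodule_iff, simplified]
    have add: "(a \<oplus> a', x \<oplus>\<^bsub>M\<^esub> x') \<in> J" if "(a, x) \<in> J" "(a', x') \<in> J" for a x a' x'
      using AA.submoduleE(5)[OF J that] by simp
    have "(\<zero>, \<zero>\<^bsub>M\<^esub>) \<in> J" using J[unfolded AA.submodule_iff] by simp
    then show ?thesis
      unfolding P.submodule_iff using Ix memJ[OF J] add mult0[OF J] by (auto simp: trace_def)
  qed
  have trace_zero: "J = {\<zero>\<^bsub>?AA\<^esub>}" if J: "submodule J ?A ?AA" and tr: "trace J \<subseteq> {\<zero>\<^bsub>?P\<^esub>}" for J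
  proof -
    have 0: "x = \<zero>\<^bsub>M\<^esub> \<and> a = \<zero>" if "(a, x) \<in> J" "a \<in> annihilator R M (carrier M)" for a x
      using tr that unfolding trace_def by auto
    have "a = \<zero> \<and> x = \<zero>\<^bsub>M\<^esub>" if ax: "(a, x) \<in> J" for a x
    proof -
      have "a \<odot>\<^bsub>M\<^esub> y = \<zero>\<^bsub>M\<^esub>" if y: "y \<in> carrier M" for y
      proof -
        have "(\<zero>, a \<odot>\<^bsub>M\<^esub> y) \<in> J"
          using mult[OF J ax R.zero_closed y] memJ[OF J ax] y by simp
        then show ?thesis using 0 z by blast
      qed
      then have "a \<in> annihilator R M (carrier M)"
        using memJ[OF J ax] unfolding annihilator_def by blast
      then show ?thesis using 0 ax by blast
    qed
    moreover have "\<zero>\<^bsub>?AA\<^esub> \<in> J" using J unfolding AA.submodule_iff by blast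
    ultimately show ?thesis
      by (intro equalityI subsetI) (metis singleton_iff surj_pair regular_module_simps(2)
          trivial_extension_simps(2), blast)
  qed
  have "strongly_CS_module ?A ?AA"
    unfolding strongly_CS_module_def
  proof (intro allI impI)
    fix J assume J: "submodule J ?A ?AA"
    obtain h where h: "h \<in> carrier R" "h \<otimes> h = h"
      and ess: "essential_submodule R ?P (trace J) ((\<lambda>p. h \<odot>\<^bsub>?P\<^esub> p) ` carrier ?P)"
      using assms trace[OF J] unfolding strongly_CS_module_def by metis
    define f where "f = (h, \<zero>\<^bsub>M\<^esub>)"
    have f: "f \<in> carrier ?A" "f \<otimes>\<^bsub>?A\<^esub> f = f" using h by (simp_all add: f_def)
    have fax: "f \<odot>\<^bsub>?AA\<^esub> (a, x) = (h \<otimes> a, h \<odot>\<^bsub>M\<^esub> x)" if "a \<in> carrier R" "x \<in> carrier M" for a x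
      using that h by (simp add: f_def)
    have hR: "h \<otimes> (h \<otimes> a) = h \<otimes> a" if "a \<in> carrier R" for a
      using that h by (simp flip: R.m_assoc)
    have hM: "h \<odot>\<^bsub>M\<^esub> (h \<odot>\<^bsub>M\<^esub> x) = h \<odot>\<^bsub>M\<^esub> x" if "x \<in> carrier M" for x
      using that h by (simp flip: smult_assoc1)
    let ?K = "(\<lambda>p. f \<odot>\<^bsub>?AA\<^esub> p) ` carrier ?AA"
    let ?Z = "J \<inter> {p \<in> carrier ?AA. f \<odot>\<^bsub>?AA\<^esub> p = \<zero>\<^bsub>?AA\<^esub>}"
    have Z: "submodule ?Z ?A ?AA"
      by (intro AA.submodule_Int J AA.submodule_kernel_smult f)
    have trfix: "h \<odot>\<^bsub>M\<^esub> x = x \<and> h \<otimes> a = a" if tr: "(x, a) \<in> trace J" for x a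
    proof -
      have "(x, a) \<in> (\<lambda>p. h \<odot>\<^bsub>?P\<^esub> p) ` carrier ?P"
        using tr ess unfolding essential_submodule_def by blast
      then obtain x' a' where "x' \<in> carrier M" "a' \<in> annihilator R M (carrier M)"
        "x = h \<odot>\<^bsub>M\<^esub> x'" "a = h \<otimes> a'"
        by auto
      then show ?thesis using hR hM annD(1) by auto
    qed
    have "trace ?Z \<subseteq> {\<zero>\<^bsub>?P\<^esub>}"
    proof
      fix p assume p: "p \<in> trace ?Z"
      obtain x a where xa: "p = (x, a)" by (cases p)
      with p have ax: "(a, x) \<in> J" "f \<odot>\<^bsub>?AA\<^esub> (a, x) = \<zero>\<^bsub>?AA\<^esub>" "(x, a) \<in> trace J"
        by (auto simp: trace_def)
      then have "h \<otimes> a = \<zero>" "h \<odot>\<^bsub>M\<^esub> x = \<zero>\<^bsub>M\<^esub>"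
        using fax memJ[OF J ax(1)] by auto
      then show "p \<in> {\<zero>\<^bsub>?P\<^esub>}" using trfix[OF ax(3)] xa by simp
    qed
    then have Z0: "?Z = {\<zero>\<^bsub>?AA\<^esub>}" by (rule trace_zero[OF Z])
    \<comment> \<open>The part of \<open>J\<close> killed by \<open>f\<close> has zero trace, hence is zero; it contains \<open>(1 - f)J\<close>.\<close>
    have JK: "J \<subseteq> ?K"
    proof
      fix p assume p: "p \<in> J"
      obtain a x where ax: "p = (a, x)" by (cases p)
      have c: "a \<in> carrier R" "x \<in> carrier M" using memJ[OF J] p ax by auto
      let ?q = "((\<one> \<ominus> h) \<otimes> a, (\<one> \<ominus> h) \<odot>\<^bsub>M\<^esub> x)"
      have qJ: "?q \<in> J" using mult0[OF J, of a x "\<one> \<ominus> h"] p ax h by simp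
      have "h \<otimes> (\<one> \<ominus> h) = h \<ominus> h \<otimes> h" using h(1) by algebra
      then have h0: "h \<otimes> (\<one> \<ominus> h) = \<zero>" using h by simp
      have "f \<odot>\<^bsub>?AA\<^esub> ?q = (h \<otimes> (\<one> \<ominus> h) \<otimes> a, (h \<otimes> (\<one> \<ominus> h)) \<odot>\<^bsub>M\<^esub> x)"
        using c h(1) by (subst fax) (simp_all add: R.m_assoc smult_assoc1)
      then have "f \<odot>\<^bsub>?AA\<^esub> ?q = \<zero>\<^bsub>?AA\<^esub>" unfolding h0 using c by simp
      then have "?q \<in> ?Z" using qJ c h by simp
      then have "?q = \<zero>\<^bsub>?AA\<^esub>" using Z0 by blast
      then have q0: "(\<one> \<ominus> h) \<otimes> a = \<zero>" "(\<one> \<ominus> h) \<odot>\<^bsub>M\<^esub> x = \<zero>\<^bsub>M\<^esub>" by simp_all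
      have "a = (\<one> \<ominus> h) \<otimes> a \<oplus> h \<otimes> a" using c h(1) by algebra
      then have "a = h \<otimes> a" using q0 c h by simp
      moreover have "x = h \<odot>\<^bsub>M\<^esub> x"
        using smult_one_minus_add[OF h(1) c(2)] q0 c h by simp
      ultimately have "p = f \<odot>\<^bsub>?AA\<^esub> (a, x)" using fax[OF c] ax by simp
      then show "p \<in> ?K" using c by auto
    qed
    have "essential_submodule ?A ?AA J ?K"
      unfolding essential_submodule_def
    proof (intro conjI allI impI J JK AA.submodule_smult_image f)
      fix U assume U: "submodule U ?A ?AA" "U \<subseteq> ?K" "J \<inter> U = {\<zero>\<^bsub>?AA\<^esub>}"
      have "trace J \<inter> trace U = trace (J \<inter> U)" by (auto simp: trace_def)
      then have "trace J \<inter> trace U = {\<zero>\<^bsub>?P\<^esub>}" using U(3) z by (auto simp: trace_def)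
      moreover have "trace U \<subseteq> (\<lambda>p. h \<odot>\<^bsub>?P\<^esub> p) ` carrier ?P"
      proof
        fix p assume p: "p \<in> trace U"
        obtain x a where xa: "p = (x, a)" by (cases p)
        then have aU: "(a, x) \<in> U" using p by (simp add: trace_def)
        then obtain q where q: "q \<in> carrier ?AA" "(a, x) = f \<odot>\<^bsub>?AA\<^esub> q"
          using U(2) by blast
        obtain a' x' where "q = (a', x')" by (cases q)
        with q have "a' \<in> carrier R" "x' \<in> carrier M" "(a, x) = f \<odot>\<^bsub>?AA\<^esub> (a', x')"
          by simp_all
        then have "h \<otimes> a = a" "h \<odot>\<^bsub>M\<^esub> x = x" using fax hR hM by auto
        then have "p = h \<odot>\<^bsub>?P\<^esub> p" using xa by simp
        moreover have "p \<in> carrier ?P" using P.submoduleE(1)[OF trace[OF U(1)]] p by blast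
        ultimately show "p \<in> (\<lambda>p. h \<odot>\<^bsub>?P\<^esub> p) ` carrier ?P" by blast
      qed
      ultimately have "trace U = {\<zero>\<^bsub>?P\<^esub>}"
        using ess trace[OF U(1)] unfolding essential_submodule_def by blast
      then show "U = {\<zero>\<^bsub>?AA\<^esub>}" using trace_zero[OF U(1)] by blast
    qed
    then show "\<exists>e\<in>carrier ?A. e \<otimes>\<^bsub>?A\<^esub> e = e \<and>
        essential_submodule ?A ?AA J ((\<lambda>p. e \<odot>\<^bsub>?AA\<^esub> p) ` carrier ?AA)"
      using f by blast
  qed
  then show ?thesis unfolding CS_ring_def by (rule AA.strongly_CS_imp_CS)
qed

end

theorem theorem5p4:
  fixes R :: "('a, 'r) ring_scheme" and M :: "('a, 'b, 'm) module_scheme"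
  assumes "module R M"
  shows
    "(CS_ring (trivial_extension R M) \<longleftrightarrow>
        CS_ring_direct_summand R (annihilator R M (carrier M)) \<and> weakly_IN_module R M) \<and>
     (CS_ring (trivial_extension R M) \<longleftrightarrow>
        CS_ring_direct_summand R (annihilator R M (carrier M)) \<and> strongly_CS_module R M) \<and>
     (CS_ring (trivial_extension R M) \<longleftrightarrow>
        weakly_IN_module R (direct_sum M (annihilator_module R M))) \<and>
     (CS_ring (trivial_extension R M) \<longleftrightarrow>
        strongly_CS_module R (direct_sum M (annihilator_module R M)))"
proof -
  interpret module R M by fact
  let ?A = "trivial_extension R M" and ?P = "direct_sum M (annihilator_module R M)"
  have P: "strongly_CS_module R ?P \<longleftrightarrow> weakly_IN_module R ?P"
    using module.strongly_CS_imp_weakly_IN[OF module_direct_sum[OF module_annihilator_module]]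
      weakly_IN_imp_strongly_CS_direct_sum_annihilator by blast
  have A: "CS_ring ?A \<longleftrightarrow> weakly_IN_module R ?P"
    using CS_trivial_extension_imp_weakly_IN strongly_CS_imp_CS_trivial_extension P by blast
  show ?thesis
    using A P weakly_IN_direct_sum_annihilator_iff weakly_IN_iff_strongly_CS by blast
qed

end
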